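(* Let $k$ be an algebraically closed field of characteristic $0$. Let $\mathbb{F}$ and $\mathbb{G}$ be the twists on Sweedler's Hopf algebra $H_4$ determined by the scalars $a,b,c,\mu,\nu,\tau,u,v,w\in k$, respectively $a',b',c',\mu',\nu',\tau',u',v',w'\in k$ (with $a,a'\neq0$). Then $(H_4)_{\mathbb{F}}$ and $(H_4)_{\mathbb{G}}$ are isomorphic as quasi-Hopf algebras if and only if $a=a'$ and there exist $\omega,\kappa\in k$ with $\omega\neq0$ such that $$(b',c',\mu',u')=\omega(b,c,\mu,u),\quad \nu'=\omega^2\nu+\kappa a,\quad \tau'=\omega^2\tau+\kappa,\quad v'=\omega^2v-\kappa,\quad w'=\omega^2w-\kappa.$$
   Context: $H_4$ is the Hopf algebra generated by $g,x$ with relations $g^2=1$, $x^2=0$, $xg=-gx$, and $\Delta(g)=g\otimes g$, $\Delta(x)=g\otimes x+x\otimes1$, $\varepsilon(g)=1$, $\varepsilon(x)=0$, $S(g)=g$, $S(x)=-gx$; it is viewed as a quasi-Hopf algebra with $\Phi=1\otimes1\otimes1$, $\alpha=\beta=1$. Put $p_\pm=\frac12(1\pm g)$. A twist on $H_4$ is an invertible $F=F^1\otimes F^2\in H_4\otimes H_4$ (summation understood) with $\varepsilon(F^1)F^2=1=\varepsilon(F^2)F^1$. Every twist has, for unique scalars with $a\neq0$, the form $$F=p_+\otimes1+p_-\otimes p_++a\,p_-\otimes p_-+b\,p_-\otimes p_-x+c\,p_-\otimes p_+x+\mu\,p_-x\otimes p_-+\nu\,p_-x\otimes p_-x+\tau\,p_-x\otimes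 p_+x+u\,p_+x\otimes p_-+v\,p_+x\otimes p_-x+w\,p_+x\otimes p_+x,$$ and these are the scalars determining $F$. For a quasi-Hopf algebra $(H,\Delta,\varepsilon,\Phi,S,\alpha,\beta)$ and a twist $F$ with $F^{-1}=G^1\otimes G^2$, $H_F$ is the same algebra with the same $\varepsilon$ and $S$, and $\Delta_F(h)=F\Delta(h)F^{-1}$, $\Phi_F=(1\otimes F)(\mathrm{id}\otimes\Delta)(F)\,\Phi\,(\Delta\otimes\mathrm{id})(F^{-1})(F^{-1}\otimes1)$, $\alpha_F=S(G^1)\alpha G^2$, $\beta_F=F^1\beta S(F^2)$. A quasi-Hopf algebra isomorphism is an algebra isomorphism compatible with comultiplications, counits, antipodes, and carrying reassociator, $\alpha$, $\beta$ to the corresponding reassociator, $\alpha$, $\beta$. *)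

theory Defs
  imports "HOL-Analysis.Cartesian_Space" "HOL-Computational_Algebra.Polynomial"
begin

section \<open>Finite-dimensional algebras and their tensor powers\<close>

text \<open>
  A finite-dimensional vector space with a chosen basis indexed by \<open>'i\<close> is \<open>'k ^ 'i\<close>; the tensor
  product of \<open>'k ^ 'i\<close> and \<open>'k ^ 'j\<close> is \<open>'k ^ ('i \<times> 'j)\<close>, with the pair \<open>(i, j)\<close> indexing the
  tensor product of the \<open>i\<close>-th and the \<open>j\<close>-th basis vector.  The triple tensor power is bracketed
  to the right.  The library's instance of \<open>times\<close> for \<open>'k ^ 'i\<close> is the coordinatewise product and
  is not used anywhere below; algebra structures are explicit functions.
\<close>

definition tens :: "'k::field ^ 'i::finite \<Rightarrow> 'k ^ 'j::finite \<Rightarrow> 'k ^ ('i \<times> 'j)"  (infixr \<open>\<otimes>\<^sub>t\<close> 75)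
  where "a \<otimes>\<^sub>t b = (\<chi> p. case p of (i, j) \<Rightarrow> a $ i * b $ j)"

definition lin_ext :: "('i \<Rightarrow> 'k::field ^ 'j) \<Rightarrow> 'k ^ 'i \<Rightarrow> 'k ^ 'j"
  where "lin_ext f a = (\<Sum>i\<in>UNIV. a $ i *s f i)"

definition bilin_ext :: "('i \<Rightarrow> 'j \<Rightarrow> 'k::field ^ 'l) \<Rightarrow> 'k ^ 'i \<Rightarrow> 'k ^ 'j \<Rightarrow> 'k ^ 'l"
  where "bilin_ext f a b = (\<Sum>i\<in>UNIV. \<Sum>j\<in>UNIV. (a $ i * b $ j) *s f i j)"

definition tens_map ::
  "('k::field ^ 'i::finite \<Rightarrow> 'k ^ 'l::finite) \<Rightarrow> ('k ^ 'j::finite \<Rightarrow> 'k ^ 'm::finite) \<Rightarrow> 'k ^ ('i \<times> 'j) \<Rightarrow> 'k ^ ('l \<times> 'm)"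
  where "tens_map f g = lin_ext (\<lambda>(i, j). f (axis i 1) \<otimes>\<^sub>t g (axis j 1))"

definition tens_mult ::
  "('k::field ^ 'i::finite \<Rightarrow> 'k ^ 'i \<Rightarrow> 'k ^ 'i) \<Rightarrow> ('k ^ 'j::finite \<Rightarrow> 'k ^ 'j \<Rightarrow> 'k ^ 'j)
    \<Rightarrow> 'k ^ ('i \<times> 'j) \<Rightarrow> 'k ^ ('i \<times> 'j) \<Rightarrow> 'k ^ ('i \<times> 'j)"
  where "tens_mult m n =
    bilin_ext (\<lambda>(i, j) (i', j'). m (axis i 1) (axis i' 1) \<otimes>\<^sub>t n (axis j 1) (axis j' 1))"

definition tens_assoc :: "'k ^ (('i::finite \<times> 'j::finite) \<times> 'l::finite) \<Rightarrow> 'k ^ ('i \<times> 'j \<times> 'l)"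
  where "tens_assoc t = (\<chi> p. case p of (i, j, l) \<Rightarrow> t $ ((i, j), l))"

text \<open>The two-sided inverse of an element; meaningful only if it exists.\<close>

definition alg_inv :: "('v \<Rightarrow> 'v \<Rightarrow> 'v) \<Rightarrow> 'v \<Rightarrow> 'v \<Rightarrow> 'v"
  where "alg_inv m e a = (THE b. m a b = e \<and> m b a = e)"


section \<open>Quasi-Hopf structures, twisting and isomorphism\<close>

text \<open>
  Only the data are recorded; the quasi-Hopf axioms play no role in the notion of isomorphism, which
  refers to the data alone.
\<close>

record ('k, 'i::finite) quasi_hopf =
  qmult :: "'k ^ 'i \<Rightarrow> 'k ^ 'i \<Rightarrow> 'k ^ 'i"
  qunit :: "'k ^ 'i"
  qcomult :: "'k ^ 'i \<Rightarrow> 'k ^ ('i \<times> 'i)"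
  qcounit :: "'k ^ 'i \<Rightarrow> 'k"
  qassoc :: "'k ^ ('i \<times> 'i \<times> 'i)"
  qantipode :: "'k ^ 'i \<Rightarrow> 'k ^ 'i"
  qalpha :: "'k ^ 'i"
  qbeta :: "'k ^ 'i"

definition qmult2 ::
  "('k::field, 'i::finite) quasi_hopf \<Rightarrow> 'k ^ ('i \<times> 'i) \<Rightarrow> 'k ^ ('i \<times> 'i) \<Rightarrow> 'k ^ ('i \<times> 'i)"
  where "qmult2 H = tens_mult (qmult H) (qmult H)"

definition qunit2 ::
  "('k::field, 'i::finite) quasi_hopf \<Rightarrow> 'k ^ ('i \<times> 'i)"
  where "qunit2 H = qunit H \<otimes>\<^sub>t qunit H"

definition qmult3 ::
  "('k::field, 'i::finite) quasi_hopf \<Rightarrow> 'k ^ ('i \<times> 'i \<times> 'i) \<Rightarrow> 'k ^ ('i \<times> 'i \<times> 'i) \<Rightarrow> 'k ^ ('i \<times> 'i \<times> 'i)"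
  where "qmult3 H = tens_mult (qmult H) (qmult2 H)"

definition qinv2 ::
  "('k::field, 'i::finite) quasi_hopf \<Rightarrow> 'k ^ ('i \<times> 'i) \<Rightarrow> 'k ^ ('i \<times> 'i)"
  where "qinv2 H = alg_inv (qmult2 H) (qunit2 H)"

text \<open>
  Twists: invertible with \<open>\<epsilon>(F\<^sup>1) F\<^sup>2 = 1 = \<epsilon>(F\<^sup>2) F\<^sup>1\<close>.
\<close>

definition is_twist :: "('k::field, 'i::finite) quasi_hopf \<Rightarrow> 'k ^ ('i \<times> 'i) \<Rightarrow> bool"
  where "is_twist H F \<longleftrightarrow>
    (\<exists>G. qmult2 H F G = qunit2 H \<and> qmult2 H G F = qunit2 H) \<and>
    lin_ext (\<lambda>(i, j). qcounit H (axis i 1) *s axis j 1) F = qunit H \<and>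
    lin_ext (\<lambda>(i, j). qcounit H (axis j 1) *s axis i 1) F = qunit H"

definition twist_assoc ::
  "('k::field, 'i::finite) quasi_hopf \<Rightarrow> 'k ^ ('i \<times> 'i) \<Rightarrow> 'k ^ ('i \<times> 'i \<times> 'i)"
  where "twist_assoc H F =
    (let G = qinv2 H F; m = qmult3 H in
      m (m (m (m (qunit H \<otimes>\<^sub>t F)
                 (tens_map id (qcomult H) F))
              (qassoc H))
           (tens_assoc (tens_map (qcomult H) id G)))
        (tens_assoc (G \<otimes>\<^sub>t qunit H)))"

text \<open>With \<open>G\<close> the inverse of \<open>F\<close>: \<open>S(G\<^sup>1) \<alpha> G\<^sup>2\<close> and \<open>F\<^sup>1 \<beta> S(F\<^sup>2)\<close>.\<close>

definition twist_alpha :: "('k::field, 'i::finite) quasi_hopf \<Rightarrow> 'k ^ ('i \<times> 'i) \<Rightarrow> 'k ^ 'i"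
  where "twist_alpha H F =
    lin_ext (\<lambda>(i, j). qmult H (qmult H (qantipode H (axis i 1)) (qalpha H)) (axis j 1)) (qinv2 H F)"

definition twist_beta :: "('k::field, 'i::finite) quasi_hopf \<Rightarrow> 'k ^ ('i \<times> 'i) \<Rightarrow> 'k ^ 'i"
  where "twist_beta H F =
    lin_ext (\<lambda>(i, j). qmult H (qmult H (axis i 1) (qbeta H)) (qantipode H (axis j 1))) F"

definition twisted ::
  "('k::field, 'i::finite) quasi_hopf \<Rightarrow> 'k ^ ('i \<times> 'i) \<Rightarrow> ('k, 'i) quasi_hopf"
  where "twisted H F = H\<lparr>
    qcomult := (\<lambda>h. qmult2 H (qmult2 H F (qcomult H h)) (qinv2 H F)),
    qassoc := twist_assoc H F,
    qalpha := twist_alpha H F,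
    qbeta := twist_beta H F\<rparr>"

definition quasi_hopf_iso ::
  "('k::field, 'i::finite) quasi_hopf \<Rightarrow> ('k, 'j::finite) quasi_hopf
    \<Rightarrow> ('k ^ 'i \<Rightarrow> 'k ^ 'j) \<Rightarrow> bool"
  where "quasi_hopf_iso A B f \<longleftrightarrow>
    Vector_Spaces.linear (*s) (*s) f \<and> bij f \<and>
    f (qunit A) = qunit B \<and>
    (\<forall>a b. f (qmult A a b) = qmult B (f a) (f b)) \<and>
    (\<forall>a. tens_map f f (qcomult A a) = qcomult B (f a)) \<and>
    (\<forall>a. qcounit B (f a) = qcounit A a) \<and>
    (\<forall>a. f (qantipode A a) = qantipode B (f a)) \<and>
    tens_map f (tens_map f f) (qassoc A) = qassoc B \<and>
    f (qalpha A) = qalpha B \<and>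
    f (qbeta A) = qbeta B"

definition quasi_hopf_isomorphic ::
  "('k::field, 'i::finite) quasi_hopf \<Rightarrow> ('k, 'j::finite) quasi_hopf \<Rightarrow> bool"
  where "quasi_hopf_isomorphic A B \<longleftrightarrow> (\<exists>f. quasi_hopf_iso A B f)"


section \<open>Sweedler's Hopf algebra\<close>

text \<open>
  The basis vector with index \<open>(p, q)\<close> is \<open>g\<^sup>p x\<^sup>q\<close>, where \<open>True\<close> stands for exponent 1.  The
  relations give \<open>g\<^sup>p x\<^sup>q g\<^sup>r x\<^sup>s = (-1)\<^sup>q\<^sup>r g\<^sup>p\<^sup>+\<^sup>r x\<^sup>q\<^sup>+\<^sup>s\<close> with \<open>g\<^sup>2 = 1\<close>, \<open>x\<^sup>2 = 0\<close>.
\<close>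

type_synonym h4_index = "bool \<times> bool"
type_synonym 'k h4 = "'k ^ h4_index"

definition h4_mult :: "'k::field h4 \<Rightarrow> 'k h4 \<Rightarrow> 'k h4"  (infixl \<open>\<bullet>\<^sub>h\<close> 78)
  where "h4_mult = bilin_ext (\<lambda>(p, q) (r, s).
    if q \<and> s then 0 else (if q \<and> r then -1 else 1) *s axis (p \<noteq> r, q \<or> s) 1)"

definition h4_one :: "'k::field h4" where "h4_one = axis (False, False) 1"
definition h4_g :: "'k::field h4" where "h4_g = axis (True, False) 1"
definition h4_x :: "'k::field h4" where "h4_x = axis (False, True) 1"

text \<open>
  \<open>\<Delta>\<close> and \<open>\<epsilon>\<close> are extended from the generators as algebra maps, \<open>S\<close> as an algebra antimorphism;
  in particular \<open>\<epsilon>(g\<^sup>p x) = 0\<close>.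
\<close>

definition h4_comult :: "'k::field h4 \<Rightarrow> 'k ^ (h4_index \<times> h4_index)"
  where "h4_comult = lin_ext (\<lambda>(p, q). tens_mult (\<bullet>\<^sub>h) (\<bullet>\<^sub>h)
    (if p then h4_g \<otimes>\<^sub>t h4_g else h4_one \<otimes>\<^sub>t h4_one)
    (if q then h4_g \<otimes>\<^sub>t h4_x + h4_x \<otimes>\<^sub>t h4_one else h4_one \<otimes>\<^sub>t h4_one))"

definition h4_counit :: "'k::field h4 \<Rightarrow> 'k"
  where "h4_counit a = a $ (False, False) + a $ (True, False)"

definition h4_antipode :: "'k::field h4 \<Rightarrow> 'k h4"
  where "h4_antipode = lin_ext (\<lambda>(p, q).
    (if q then - (h4_g \<bullet>\<^sub>h h4_x) else h4_one) \<bullet>\<^sub>h (if p then h4_g else h4_one))"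

definition H4 :: "('k::field, h4_index) quasi_hopf"
  where "H4 = \<lparr>
    qmult = (\<bullet>\<^sub>h), qunit = h4_one,
    qcomult = h4_comult, qcounit = h4_counit,
    qassoc = h4_one \<otimes>\<^sub>t h4_one \<otimes>\<^sub>t h4_one,
    qantipode = h4_antipode, qalpha = h4_one, qbeta = h4_one\<rparr>"

definition h4_pp :: "'k::field h4"  (\<open>p\<^sub>+\<close>)
  where "p\<^sub>+ = (1 / 2) *s (h4_one + h4_g)"

definition h4_pm :: "'k::field h4"  (\<open>p\<^sub>-\<close>)
  where "p\<^sub>- = (1 / 2) *s (h4_one - h4_g)"

definition h4_twist ::
  "'k::field \<Rightarrow> 'k \<Rightarrow> 'k \<Rightarrow> 'k \<Rightarrow> 'k \<Rightarrow> 'k \<Rightarrow> 'k \<Rightarrow> 'k \<Rightarrow> 'k \<Rightarrow> 'k ^ (h4_index \<times> h4_index)"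
  where "h4_twist a b c \<mu> \<nu> \<tau> u v w =
    p\<^sub>+ \<otimes>\<^sub>t h4_one + p\<^sub>- \<otimes>\<^sub>t p\<^sub>+ + a *s (p\<^sub>- \<otimes>\<^sub>t p\<^sub>-)
    + b *s (p\<^sub>- \<otimes>\<^sub>t p\<^sub>- \<bullet>\<^sub>h h4_x) + c *s (p\<^sub>- \<otimes>\<^sub>t p\<^sub>+ \<bullet>\<^sub>h h4_x)
    + \<mu> *s (p\<^sub>- \<bullet>\<^sub>h h4_x \<otimes>\<^sub>t p\<^sub>-)
    + \<nu> *s (p\<^sub>- \<bullet>\<^sub>h h4_x \<otimes>\<^sub>t p\<^sub>- \<bullet>\<^sub>h h4_x) + \<tau> *s (p\<^sub>- \<bullet>\<^sub>h h4_x \<otimes>\<^sub>t p\<^sub>+ \<bullet>\<^sub>h h4_x)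
    + u *s (p\<^sub>+ \<bullet>\<^sub>h h4_x \<otimes>\<^sub>t p\<^sub>-)
    + v *s (p\<^sub>+ \<bullet>\<^sub>h h4_x \<otimes>\<^sub>t p\<^sub>- \<bullet>\<^sub>h h4_x) + w *s (p\<^sub>+ \<bullet>\<^sub>h h4_x \<otimes>\<^sub>t p\<^sub>+ \<bullet>\<^sub>h h4_x)"


section \<open>Relations of H4 and invertibility of the twists\<close>

lemma UNIV_h4_index: "(UNIV :: h4_index set) = {(False, False), (True, False), (False, True), (True, True)}"
  by (auto simp: set_eq_iff)

lemma h4_mult_nth:
  "(a \<bullet>\<^sub>h b) $ (False, False) = a $ (False, False) * b $ (False, False) + a $ (True, False) * b $ (True, False)"
  "(a \<bullet>\<^sub>h b) $ (True, False) = a $ (False, False) * b $ (True, False) + a $ (True, False) * b $ (False, False)"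
  "(a \<bullet>\<^sub>h b) $ (False, True) = a $ (False, False) * b $ (False, True) + a $ (True, False) * b $ (True, True)
     + a $ (False, True) * b $ (False, False) - a $ (True, True) * b $ (True, False)"
  "(a \<bullet>\<^sub>h b) $ (True, True) = a $ (False, False) * b $ (True, True) + a $ (True, False) * b $ (False, True)
     + a $ (True, True) * b $ (False, False) - a $ (False, True) * b $ (True, False)"
  by (simp_all add: h4_mult_def bilin_ext_def UNIV_h4_index axis_def)

lemma h4_eqI:
  assumes "a $ (False, False) = b $ (False, False)" "a $ (True, False) = b $ (True, False)"
    "a $ (False, True) = b $ (False, True)" "a $ (True, True) = b $ (True, True)"
  shows "a = (b :: 'k::field h4)"
  using assms by (simp add: vec_eq_iff all_bool_eq)

lemma h4_algebra:
  "h4_one \<bullet>\<^sub>h a = a" "a \<bullet>\<^sub>h h4_one = a" "(a \<bullet>\<^sub>h b) \<bullet>\<^sub>h c = a \<bullet>\<^sub>h (b \<bullet>\<^sub>h c)"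
  by (rule h4_eqI; simp add: h4_mult_nth h4_one_def axis_def algebra_simps)+

lemma h4_relations:
  "h4_g \<bullet>\<^sub>h h4_g = (h4_one :: 'k::field h4)" "h4_x \<bullet>\<^sub>h h4_x = (0 :: 'k h4)"
  "h4_x \<bullet>\<^sub>h h4_g = - (h4_g \<bullet>\<^sub>h (h4_x :: 'k h4))"
  by (rule h4_eqI; simp add: h4_mult_nth h4_one_def h4_g_def h4_x_def axis_def)+


lemma bilin_ext_axis [simp]: "bilin_ext f (axis i 1) (axis j 1) = f i j"
proof -
  have "bilin_ext f (axis i 1) (axis j 1) = (\<Sum>i'\<in>UNIV. \<Sum>j'\<in>UNIV. if j' = j then if i' = i then f i' j' else 0 else 0)"
    unfolding bilin_ext_def by (intro sum.cong refl) (auto simp: axis_def)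
  then show ?thesis by simp
qed

lemma sum_UNIV_pair: "(\<Sum>p\<in>UNIV. f p) = (\<Sum>i\<in>UNIV. \<Sum>j\<in>UNIV. f (i, j))"
  for f :: "'i::finite \<times> 'j::finite \<Rightarrow> 'a::comm_monoid_add"
  by (simp add: sum.cartesian_product)

lemma tens_mult_tens:
  fixes a c :: "'k::field ^ 'i::finite" and b d :: "'k ^ 'j::finite"
  shows "tens_mult (bilin_ext f) (bilin_ext g) (a \<otimes>\<^sub>t b) (c \<otimes>\<^sub>t d) = bilin_ext f a c \<otimes>\<^sub>t bilin_ext g b d"
proof -
  have "(\<Sum>i\<in>UNIV. \<Sum>j\<in>UNIV. \<Sum>i'\<in>UNIV. \<Sum>j'\<in>UNIV. a $ i * b $ j * (c $ i' * d $ j') * (f i i' $ k * g j j' $ l)) =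
     (\<Sum>i\<in>UNIV. \<Sum>i'\<in>UNIV. a $ i * c $ i' * f i i' $ k) * (\<Sum>j\<in>UNIV. \<Sum>j'\<in>UNIV. b $ j * d $ j' * g j j' $ l)"
    for k l
    unfolding sum_distrib_right unfolding sum_distrib_left
    by (intro sum.cong refl, subst sum.swap, intro sum.cong refl) (simp add: mult_ac)
  then show ?thesis
    unfolding tens_mult_def bilin_ext_axis unfolding bilin_ext_def tens_def
    by (simp add: vec_eq_iff sum_UNIV_pair sum_component)
qed

lemmas h4_tens_mult = tens_mult_tens[of
  "\<lambda>(p, q) (r, s). if q \<and> s then 0 else (if q \<and> r then -1 else 1) *s axis (p \<noteq> r, q \<or> s) 1"
  "\<lambda>(p, q) (r, s). if q \<and> s then 0 else (if q \<and> r then -1 else 1) *s axis (p \<noteq> r, q \<or> s) 1",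
  folded h4_mult_def]


lemma lin_ext_axis: "lin_ext f (axis i 1) = f i"
proof -
  have "lin_ext f (axis i 1) = (\<Sum>i'\<in>UNIV. if i' = i then f i' else 0)"
    unfolding lin_ext_def by (intro sum.cong refl) (auto simp: axis_def)
  then show ?thesis by simp
qed

lemma lin_ext_linear:
  "lin_ext f (a + b) = lin_ext f a + lin_ext f b" "lin_ext f (r *s a) = r *s lin_ext f a"
  by (simp_all add: lin_ext_def vec_eq_iff sum_component sum.distrib sum_distrib_left algebra_simps)

lemma bilin_ext_bilinear:
  "bilin_ext f (a + a') b = bilin_ext f a b + bilin_ext f a' b"
  "bilin_ext f a (b + b') = bilin_ext f a b + bilin_ext f a b'"
  "bilin_ext f (r *s a) b = r *s bilin_ext f a b"
  "bilin_ext f a (r *s b) = r *s bilin_ext f a b"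
  by (simp_all add: bilin_ext_def vec_eq_iff sum_component sum.distrib sum_distrib_left algebra_simps)

lemma tens_mult_bilinear:
  "tens_mult m n (a + a') b = tens_mult m n a b + tens_mult m n a' b"
  "tens_mult m n a (b + b') = tens_mult m n a b + tens_mult m n a b'"
  "tens_mult m n (r *s a) b = r *s tens_mult m n a b"
  "tens_mult m n a (r *s b) = r *s tens_mult m n a b"
  unfolding tens_mult_def by (rule bilin_ext_bilinear)+

lemma h4_mult_bilinear:
  "(a + a') \<bullet>\<^sub>h b = a \<bullet>\<^sub>h b + a' \<bullet>\<^sub>h b" "a \<bullet>\<^sub>h (b + b') = a \<bullet>\<^sub>h b + a \<bullet>\<^sub>h b'"
  "(r *s a) \<bullet>\<^sub>h b = r *s (a \<bullet>\<^sub>h b)" "a \<bullet>\<^sub>h (r *s b) = r *s (a \<bullet>\<^sub>h b)"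
  "0 \<bullet>\<^sub>h b = 0" "a \<bullet>\<^sub>h 0 = 0"
  "(- a) \<bullet>\<^sub>h b = - (a \<bullet>\<^sub>h b)" "a \<bullet>\<^sub>h (- b) = - (a \<bullet>\<^sub>h b)"
  by (rule h4_eqI; simp add: h4_mult_nth algebra_simps)+

lemma tens_bilinear:
  "(a + a') \<otimes>\<^sub>t b = a \<otimes>\<^sub>t b + a' \<otimes>\<^sub>t b" "a \<otimes>\<^sub>t (b + b') = a \<otimes>\<^sub>t b + a \<otimes>\<^sub>t b'"
  "(r *s a) \<otimes>\<^sub>t b = r *s (a \<otimes>\<^sub>t b)" "a \<otimes>\<^sub>t (r *s b) = r *s (a \<otimes>\<^sub>t b)"
  "0 \<otimes>\<^sub>t b = 0" "a \<otimes>\<^sub>t 0 = 0"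
  "(- a) \<otimes>\<^sub>t b = - (a \<otimes>\<^sub>t b)" "a \<otimes>\<^sub>t (- b) = - (a \<otimes>\<^sub>t b)"
  by (simp_all add: tens_def vec_eq_iff algebra_simps)

lemma h4_comult_generators:
  "h4_comult h4_one = (h4_one \<otimes>\<^sub>t h4_one :: 'k::field ^ (h4_index \<times> h4_index))"
  "h4_comult h4_g = (h4_g \<otimes>\<^sub>t h4_g :: 'k ^ (h4_index \<times> h4_index))"
  "h4_comult h4_x = (h4_g \<otimes>\<^sub>t h4_x + h4_x \<otimes>\<^sub>t h4_one :: 'k ^ (h4_index \<times> h4_index))"
  by (simp_all add: h4_comult_def h4_one_def[symmetric] h4_tens_mult h4_algebra tens_mult_bilinear
      lin_ext_axis[of _ "(False, False)", folded h4_one_def]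
      lin_ext_axis[of _ "(True, False)", folded h4_g_def] lin_ext_axis[of _ "(False, True)", folded h4_x_def])

lemma h4_antipode_generators:
  "h4_antipode h4_g = (h4_g :: 'k::field h4)" "h4_antipode h4_x = - (h4_g \<bullet>\<^sub>h (h4_x :: 'k h4))"
  by (simp_all add: h4_antipode_def h4_algebra
      lin_ext_axis[of _ "(True, False)", folded h4_g_def] lin_ext_axis[of _ "(False, True)", folded h4_x_def])

lemma h4_expand:
  "a = a $ (False, False) *s h4_one + a $ (True, False) *s h4_g
     + a $ (False, True) *s h4_x + a $ (True, True) *s (h4_g \<bullet>\<^sub>h (h4_x :: 'k::field h4))"
  by (rule h4_eqI; simp add: h4_mult_nth h4_one_def h4_g_def h4_x_def axis_def)

lemma h4_gx: "h4_g \<bullet>\<^sub>h h4_x = (axis (True, True) 1 :: 'k::field h4)"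
  by (rule h4_eqI; simp add: h4_mult_nth h4_g_def h4_x_def axis_def)

lemma h4_comult_gx:
  "h4_comult (h4_g \<bullet>\<^sub>h h4_x) = tens_mult (\<bullet>\<^sub>h) (\<bullet>\<^sub>h) (h4_comult h4_g) (h4_comult (h4_x :: 'k::field h4))"
  unfolding h4_comult_generators h4_gx unfolding h4_comult_def lin_ext_axis by simp

lemma h4_normalize:
  fixes a :: "'k::field h4"
  shows "h4_x \<bullet>\<^sub>h h4_g = (-1) *s (h4_g \<bullet>\<^sub>h (h4_x :: 'k h4))" "h4_x \<bullet>\<^sub>h (h4_g \<bullet>\<^sub>h a) = (-1) *s (h4_g \<bullet>\<^sub>h (h4_x \<bullet>\<^sub>h a))"
    "h4_g \<bullet>\<^sub>h (h4_g \<bullet>\<^sub>h a) = a" "h4_x \<bullet>\<^sub>h (h4_x \<bullet>\<^sub>h a) = 0"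
  by (rule h4_eqI; simp add: h4_mult_nth h4_one_def h4_g_def h4_x_def axis_def)+

lemma h4_comult_mult:
  "h4_comult (a \<bullet>\<^sub>h b) = tens_mult (\<bullet>\<^sub>h) (\<bullet>\<^sub>h) (h4_comult a) (h4_comult (b :: 'k::field h4))"
proof -
  have l: "h4_comult (a + b) = h4_comult a + h4_comult b" "h4_comult (r *s a) = r *s h4_comult a" "h4_comult 0 = 0"
    "h4_comult (a - b) = h4_comult a - h4_comult b" "h4_comult (- a) = - h4_comult a"
    for r and a b :: "'k h4"
    by (simp_all add: h4_comult_def lin_ext_linear)
      (simp_all add: lin_ext_def vec_eq_iff sum_component sum_subtractf sum_negf algebra_simps)
  show ?thesis
    by (subst (1 2) h4_expand[of a], subst (1 2) h4_expand[of b],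
       simp add: l h4_mult_bilinear tens_mult_bilinear h4_comult_generators h4_comult_gx tens_bilinear h4_tens_mult h4_algebra h4_relations(1,2) h4_normalize)
      (simp add: vec_eq_iff algebra_simps)
qed

lemma h4_idem:
  fixes P M X Y :: "'k::field_char_0 h4"
  defines "P \<equiv> p\<^sub>+" and "M \<equiv> p\<^sub>-" and "X \<equiv> p\<^sub>+ \<bullet>\<^sub>h h4_x" and "Y \<equiv> p\<^sub>- \<bullet>\<^sub>h h4_x"
  shows "P \<bullet>\<^sub>h P = P" "P \<bullet>\<^sub>h M = 0" "P \<bullet>\<^sub>h X = X" "P \<bullet>\<^sub>h Y = 0"
    "M \<bullet>\<^sub>h P = 0" "M \<bullet>\<^sub>h M = M" "M \<bullet>\<^sub>h X = 0" "M \<bullet>\<^sub>h Y = Y"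
    "X \<bullet>\<^sub>h P = 0" "X \<bullet>\<^sub>h M = X" "X \<bullet>\<^sub>h X = 0" "X \<bullet>\<^sub>h Y = 0"
    "Y \<bullet>\<^sub>h P = Y" "Y \<bullet>\<^sub>h M = 0" "Y \<bullet>\<^sub>h X = 0" "Y \<bullet>\<^sub>h Y = 0"
    "h4_one = P + M"
    "h4_counit P = 1" "h4_counit M = 0" "h4_counit X = 0" "h4_counit Y = 0"
  unfolding assms
  by (((rule h4_eqI)?; simp add: h4_mult_nth h4_one_def h4_g_def h4_x_def h4_pp_def h4_pm_def h4_counit_def axis_def field_simps)+)

lemma h4_counit_add: "h4_counit (a + b) = h4_counit a + h4_counit b"
  by (simp add: h4_counit_def)

lemma counit_tens:
  "lin_ext (\<lambda>(i, j). h4_counit (axis i 1) *s axis j 1) (a \<otimes>\<^sub>t b) = h4_counit a *s (b :: 'k::field h4)"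
  "lin_ext (\<lambda>(i, j). h4_counit (axis j 1) *s axis i 1) (a \<otimes>\<^sub>t b) = h4_counit b *s (a :: 'k::field h4)"
  by (rule h4_eqI; simp add: lin_ext_def sum_UNIV_pair[where 'i = h4_index and 'j = h4_index] UNIV_h4_index h4_counit_def tens_def axis_def algebra_simps)+

lemma h4_twist_mult:
  fixes a b c \<mu> \<nu> \<tau> u v w :: "'k::field_char_0"
  shows "tens_mult (\<bullet>\<^sub>h) (\<bullet>\<^sub>h) (h4_twist a b c \<mu> \<nu> \<tau> u v w) (h4_twist a' b' c' \<mu>' \<nu>' \<tau>' u' v' w') =
    h4_twist (a * a') (a * b' + b) (c' + c * a') (a * \<mu>' + \<mu>) (a * \<nu>' + \<nu>) (\<tau>' + \<tau> + c * \<mu>')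
      (u' + u * a') (v' + v + u * b') (w' + w * a')"
proof -
  define P M X Y :: "'k h4" where "P = p\<^sub>+" and "M = p\<^sub>-" and "X = p\<^sub>+ \<bullet>\<^sub>h h4_x" and "Y = p\<^sub>- \<bullet>\<^sub>h h4_x"
  note idem = h4_idem[where ?'k = 'k, folded P_def M_def X_def Y_def]
  note tw = h4_twist_def[where ?'k = 'k, folded P_def M_def X_def Y_def]
  show ?thesis
    by (simp add: tw idem h4_tens_mult tens_mult_bilinear tens_bilinear)
      (simp add: vec_eq_iff algebra_simps)
qed

lemma h4_twist_trivial: "h4_twist 1 0 0 0 0 0 0 0 0 = (h4_one \<otimes>\<^sub>t h4_one :: 'k::field_char_0 ^ _)"
  by (simp add: h4_twist_def h4_idem(17) tens_bilinear)

text \<open>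
  Hence the description operator in \<open>qinv2 H4\<close> is applied to an existing (and, by associativity,
  unique) inverse for every \<open>h4_twist\<close> with \<open>a \<noteq> 0\<close>.
\<close>

lemma is_twist_h4_twist:
  fixes a b c \<mu> \<nu> \<tau> u v w :: "'k::field_char_0"
  assumes "a \<noteq> 0"
  shows "is_twist H4 (h4_twist a b c \<mu> \<nu> \<tau> u v w)"
proof -
  let ?F = "h4_twist a b c \<mu> \<nu> \<tau> u v w"
  let ?G = "h4_twist (1/a) (-b/a) (-c/a) (-\<mu>/a) (-\<nu>/a) (c*\<mu>/a-\<tau>) (-u/a) (u*b/a-v) (-w/a)"
  have "qmult2 H4 ?F ?G = qunit2 H4" "qmult2 H4 ?G ?F = qunit2 H4"
    using assms by (simp_all add: qmult2_def qunit2_def H4_def h4_twist_mult h4_twist_trivial field_simps)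
  moreover have "lin_ext (\<lambda>(i, j). qcounit H4 (axis i 1) *s axis j 1) ?F = qunit H4"
    "lin_ext (\<lambda>(i, j). qcounit H4 (axis j 1) *s axis i 1) ?F = qunit H4"
    by (simp_all add: H4_def h4_twist_def lin_ext_linear counit_tens h4_idem h4_counit_add)
  ultimately show ?thesis unfolding is_twist_def by blast
qed

end

theory Submission
  imports Defs
begin

text \<open>
  An isomorphism between two twists of \<open>H4\<close> is in particular an algebra automorphism of \<open>H4\<close> that
  preserves \<open>\<epsilon>\<close> and \<open>S\<close>, and this alone makes it a scaling \<open>g \<mapsto> g\<close>, \<open>x \<mapsto> \<omega> x\<close>
  (\<open>quasi_hopf_iso_eq_scale\<close>).  Scalings are Hopf algebra automorphisms of \<open>H4\<close>, so they carry the twist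
  by \<open>F\<close> to the twist by the image \<open>F\<omega>\<close> of \<open>F\<close> (\<open>quasi_hopf_iso_scale\<close>), whose coefficients are those
  of \<open>F\<close> multiplied by \<open>\<omega>\<close> once for every factor \<open>x\<close>.  Hence \<open>F\<close> and \<open>F'\<close> give isomorphic quasi-Hopf
  algebras if and only if, for some \<open>\<omega>\<close>, the twists by \<open>F\<omega>\<close> and by \<open>F'\<close> have the same data.

  Write \<open>F' = F\<omega> J\<close>.  The comultiplications agree if and only if \<open>J\<close> commutes with \<open>\<Delta>(h)\<close> for all \<open>h\<close>
  (\<open>twisted_comult_mult_eq_iff\<close>).  If so, \<open>1 \<otimes> J\<close> commutes with \<open>(id \<otimes> \<Delta>)(F\<omega>)\<close> and \<open>J \<otimes> 1\<close> with
  \<open>(\<Delta> \<otimes> id)(F\<omega>)\<close>; all contributions of \<open>F\<omega>\<close> to the reassociator then move to the outside and cancel, and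
  the reassociators agree if and only if \<open>J\<close> satisfies the two-cocycle equation
  \<open>(1 \<otimes> J) (id \<otimes> \<Delta>)(J) = (J \<otimes> 1) (\<Delta> \<otimes> id)(J)\<close> (\<open>twist_assoc_mult_eq_iff\<close>).

  It remains to find these invariant (or lazy) two-cocycles.  Commuting with \<open>\<Delta>(g) = g \<otimes> g\<close> removes the
  terms of \<open>J\<close> with exactly one \<open>x\<close>, and commuting with \<open>\<Delta>(x)\<close> forces the coefficient of
  \<open>p\<^sub>- \<otimes> p\<^sub>-\<close> to be 1.  So \<open>J = 1 \<otimes> 1 + N\<close> where \<open>N\<close> is a combination of the \<open>g\<^sup>i x \<otimes> g\<^sup>j x\<close>.  As \<open>x\<^sup>2 = 0\<close>,
  the cocycle equation is linear in \<open>N\<close>, and its solutions are \<open>N = - \<kappa> gx \<otimes> x\<close>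
  (\<open>invariant_cocycle_twist_iff\<close>).  Multiplying \<open>F\<omega>\<close> by such a \<open>J\<close> shifts the coefficients of the terms
  with two factors \<open>x\<close> exactly as in the theorem.  It changes neither \<open>\<alpha>\<close> nor \<open>\<beta>\<close>, because these involve
  only the other coefficients (\<open>twist_alpha_twist\<close>, \<open>twist_beta_twist\<close>).
\<close>

section \<open>Linear maps and algebras on tensor powers\<close>

lemma sum_axis: "(\<Sum>i\<in>UNIV. a $ i *s axis i 1) = (a :: 'k::field ^ 'i::finite)"
  by (simp add: vec_eq_iff sum_component axis_def if_distrib cong: if_cong)

abbreviation klinear :: "('k::field ^ 'i \<Rightarrow> 'k ^ 'j) \<Rightarrow> bool"
  where "klinear \<equiv> Vector_Spaces.linear (*s) (*s)"

lemma klinearI: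
  assumes "\<And>a b. f (a + b) = f a + f b" "\<And>r a. f (r *s a) = r *s f a"
  shows "klinear f"
  using assms by (intro Vector_Spaces.linear_iff[THEN iffD2]) (auto intro: vec.vector_space_axioms)

lemma klinearD:
  assumes "klinear f"
  shows "f (a + b) = f a + f b" "f (r *s a) = r *s f a" "f 0 = 0"
  using assms by (auto simp: Vector_Spaces.linear_iff intro: vec.linear_0)

lemma klinear_eq_lin_ext:
  assumes "klinear f"
  shows "lin_ext (\<lambda>i. f (axis i 1)) a = f (a :: 'k::field ^ 'i::finite)"
proof -
  interpret Vector_Spaces.linear "(*s)" "(*s)" f by (rule assms)
  have "f a = f (\<Sum>i\<in>UNIV. a $ i *s axis i 1)" by (simp add: sum_axis)
  then show ?thesis by (simp add: lin_ext_def sum scale)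
qed

lemma tens_axis: "axis i 1 \<otimes>\<^sub>t axis j 1 = (axis (i, j) 1 :: 'k::field ^ ('i::finite \<times> 'j::finite))"
  by (auto simp: vec_eq_iff tens_def axis_def)

text \<open>
  Additive identities on a tensor product need checking on pure tensors only.  Scalars are absorbed
  into a tensor factor, so there is no case for scalar multiples.
\<close>
lemma tens_induct [case_names add tens]:
  fixes t :: "'k::field ^ ('i::finite \<times> 'j::finite)"
  assumes add: "\<And>s t. P s \<Longrightarrow> P t \<Longrightarrow> P (s + t)" and tens: "\<And>a b. P (a \<otimes>\<^sub>t b)"
  shows "P t"
proof -
  have "P (\<Sum>p\<in>A. t $ p *s axis p 1)" if "finite A" for A
    using that
  proof induction
    case empty
    show ?case using tens[of 0 0] by (simp add: tens_bilinear)
  next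
    case (insert p A)
    obtain i j where "p = (i, j)" by fastforce
    then have "t $ p *s axis p 1 = (t $ p *s axis i 1) \<otimes>\<^sub>t axis j 1"
      by (simp add: tens_bilinear tens_axis)
    then have "P (t $ p *s axis p 1)" using tens by simp
    with insert add show ?case by simp
  qed
  from this[OF finite[of UNIV]] show ?thesis by (simp add: sum_axis)
qed

lemma tens_map_add: "tens_map f g (s + t) = tens_map f g s + tens_map f g t"
  by (simp add: tens_map_def lin_ext_linear)

lemma tens_map_scale: "tens_map f g (r *s t) = r *s tens_map f g t"
  by (simp add: tens_map_def lin_ext_linear)

lemma klinear_tens_map: "klinear (tens_map f g)"
  by (rule klinearI) (rule tens_map_add tens_map_scale)+

lemma tens_map_tens:
  fixes a :: "'k::field ^ 'i::finite" and b :: "'k ^ 'j::finite"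
  assumes "klinear f" "klinear g"
  shows "tens_map f g (a \<otimes>\<^sub>t b) = f a \<otimes>\<^sub>t g b"
proof -
  have "tens_map f g (a \<otimes>\<^sub>t b) = lin_ext (\<lambda>i. f (axis i 1)) a \<otimes>\<^sub>t lin_ext (\<lambda>j. g (axis j 1)) b"
    by (simp add: tens_map_def lin_ext_def vec_eq_iff sum_UNIV_pair sum_component tens_def
        sum_product mult_ac)
  then show ?thesis by (simp add: klinear_eq_lin_ext assms)
qed

text \<open>
  Bilinearity is stated as an equation with \<open>bilin_ext\<close> because \<open>tens_mult\<close> evaluates the two
  multiplications on basis vectors only: this is the condition under which it has the expected values
  on all pure tensors.
\<close>
locale fd_algebra =
  fixes m :: "'k::field ^ 'i::finite \<Rightarrow> 'k ^ 'i \<Rightarrow> 'k ^ 'i" and e :: "'k ^ 'i"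
  assumes bilinear: "m = bilin_ext (\<lambda>i j. m (axis i 1) (axis j 1))"
    and assoc: "m (m a b) c = m a (m b c)"
    and left_unit: "m e a = a" and right_unit: "m a e = a"
begin

lemma alg_inv_eqI:
  assumes "m a b = e" "m b a = e"
  shows "alg_inv m e a = b"
  unfolding alg_inv_def
proof (rule the_equality)
  fix c assume "m a c = e \<and> m c a = e"
  then have "c = m (m b a) c" using assms by (simp add: left_unit)
  also have "\<dots> = b" using \<open>m a c = e \<and> m c a = e\<close> by (simp add: assoc right_unit)
  finally show "c = b" .
qed (use assms in simp)

end

text \<open>
  The defining property of the tensor product of two algebras, free of bases.
\<close>
lemma tens_mult_pure:
  assumes "fd_algebra m e" "fd_algebra n d"
  shows "tens_mult m n (a \<otimes>\<^sub>t b) (a' \<otimes>\<^sub>t b') = m a a' \<otimes>\<^sub>t n b b'"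
  using tens_mult_tens fd_algebra.bilinear[OF assms(1)] fd_algebra.bilinear[OF assms(2)] by metis

lemma fd_algebra_tens_mult:
  assumes "fd_algebra m e" "fd_algebra n d"
  shows "fd_algebra (tens_mult m n) (e \<otimes>\<^sub>t d)"
proof
  note tm = tens_mult_pure[OF assms]
  interpret M: fd_algebra m e by fact
  interpret N: fd_algebra n d by fact
  show "tens_mult m n = bilin_ext (\<lambda>i j. tens_mult m n (axis i 1) (axis j 1))"
    by (simp add: tens_mult_def)
  show "tens_mult m n (e \<otimes>\<^sub>t d) t = t" for t
    by (induction t rule: tens_induct) (simp_all add: tm M.left_unit N.left_unit tens_mult_bilinear)
  show "tens_mult m n t (e \<otimes>\<^sub>t d) = t" for t
    by (induction t rule: tens_induct) (simp_all add: tm M.right_unit N.right_unit tens_mult_bilinear)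
  have *: "tens_mult m n (tens_mult m n (a \<otimes>\<^sub>t b) (c \<otimes>\<^sub>t f)) t
      = tens_mult m n (a \<otimes>\<^sub>t b) (tens_mult m n (c \<otimes>\<^sub>t f) t)" for a b c f t
    by (induction t rule: tens_induct) (simp_all add: tm M.assoc N.assoc tens_mult_bilinear)
  have **: "tens_mult m n (tens_mult m n (a \<otimes>\<^sub>t b) s) t = tens_mult m n (a \<otimes>\<^sub>t b) (tens_mult m n s t)"
    for a b s t
    by (induction s rule: tens_induct) (simp_all add: * tens_mult_bilinear)
  show "tens_mult m n (tens_mult m n r s) t = tens_mult m n r (tens_mult m n s t)" for r s t
    by (induction r rule: tens_induct) (simp_all add: ** tens_mult_bilinear)
qed

lemma tens_map_mult:
  assumes alg: "fd_algebra m e" "fd_algebra n d" "fd_algebra m' e'" "fd_algebra n' d'"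
    and lin: "klinear f" "klinear g"
    and f: "\<And>a b. f (m a b) = m' (f a) (f b)" and g: "\<And>a b. g (n a b) = n' (g a) (g b)"
  shows "tens_map f g (tens_mult m n s t) = tens_mult m' n' (tens_map f g s) (tens_map f g t)"
proof -
  have *: "tens_map f g (tens_mult m n (a \<otimes>\<^sub>t b) t)
      = tens_mult m' n' (tens_map f g (a \<otimes>\<^sub>t b)) (tens_map f g t)" for a b
    by (induction t rule: tens_induct)
      (simp_all add: tens_mult_pure[OF alg(1,2)] tens_mult_pure[OF alg(3,4)] tens_map_tens lin f g
        tens_mult_bilinear tens_map_add)
  show ?thesis
    by (induction s rule: tens_induct) (simp_all add: * tens_mult_bilinear tens_map_add)
qed

lemma tens_assoc_add: "tens_assoc (s + t) = tens_assoc s + tens_assoc t"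
  by (auto simp: tens_assoc_def vec_eq_iff)

lemma tens_assoc_scale: "tens_assoc (r *s t) = r *s tens_assoc t"
  by (auto simp: tens_assoc_def vec_eq_iff)

lemma tens_assoc_tens: "tens_assoc ((a \<otimes>\<^sub>t b) \<otimes>\<^sub>t c) = a \<otimes>\<^sub>t b \<otimes>\<^sub>t c"
  by (auto simp: tens_assoc_def tens_def vec_eq_iff mult_ac)

lemma tens3_induct [case_names add tens]:
  fixes t :: "'k::field ^ (('i::finite \<times> 'j::finite) \<times> 'l::finite)"
  assumes add: "\<And>s t. P s \<Longrightarrow> P t \<Longrightarrow> P (s + t)" and tens: "\<And>a b c. P ((a \<otimes>\<^sub>t b) \<otimes>\<^sub>t c)"
  shows "P t"
proof (induction t rule: tens_induct)
  case (tens s c)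
  show ?case by (induction s rule: tens_induct) (auto simp: tens_bilinear intro: assms)
qed (rule add)

lemma tens_assoc_mult:
  assumes "fd_algebra m e" "fd_algebra n d" "fd_algebra p f"
  shows "tens_assoc (tens_mult (tens_mult m n) p s t)
    = tens_mult m (tens_mult n p) (tens_assoc s) (tens_assoc t)"
proof -
  note tm = tens_mult_pure[OF assms(1,2)] tens_mult_pure[OF assms(2,3)]
    tens_mult_pure[OF assms(1) fd_algebra_tens_mult[OF assms(2,3)]]
    tens_mult_pure[OF fd_algebra_tens_mult[OF assms(1,2)] assms(3)]
  have *: "tens_assoc (tens_mult (tens_mult m n) p ((a \<otimes>\<^sub>t b) \<otimes>\<^sub>t c) t)
    = tens_mult m (tens_mult n p) (tens_assoc ((a \<otimes>\<^sub>t b) \<otimes>\<^sub>t c)) (tens_assoc t)" for a b c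
    by (induction t rule: tens3_induct) (simp_all add: tm tens_assoc_tens tens_assoc_add tens_mult_bilinear)
  show ?thesis
    by (induction s rule: tens3_induct) (simp_all add: * tens_assoc_add tens_mult_bilinear)
qed

section \<open>Twisting\<close>

interpretation h4: fd_algebra "(\<bullet>\<^sub>h)" "h4_one :: 'k::field h4"
proof
  show "(\<bullet>\<^sub>h) = bilin_ext (\<lambda>i j. axis i 1 \<bullet>\<^sub>h (axis j 1 :: 'k h4))"
    by (simp add: h4_mult_def)
qed (rule h4_algebra)+


abbreviation mult2 (infixl \<open>\<bullet>\<^sub>2\<close> 78) where "mult2 \<equiv> tens_mult (\<bullet>\<^sub>h) (\<bullet>\<^sub>h)"
abbreviation mult3 (infixl \<open>\<bullet>\<^sub>3\<close> 78) where "mult3 \<equiv> tens_mult (\<bullet>\<^sub>h) mult2"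
abbreviation one2 where "one2 \<equiv> h4_one \<otimes>\<^sub>t h4_one"
abbreviation one3 where "one3 \<equiv> h4_one \<otimes>\<^sub>t one2"

interpretation h4_2: fd_algebra mult2 "one2 :: 'k::field ^ _"
  by (intro fd_algebra_tens_mult h4.fd_algebra_axioms)

interpretation h4_3: fd_algebra mult3 "one3 :: 'k::field ^ _"
  by (intro fd_algebra_tens_mult h4.fd_algebra_axioms)

lemmas h4_mult2_tens = tens_mult_pure[OF h4.fd_algebra_axioms h4.fd_algebra_axioms]
lemmas h4_mult3_tens = tens_mult_pure[OF h4.fd_algebra_axioms h4_2.fd_algebra_axioms]

lemma klinear_comult: "klinear h4_comult"
  unfolding h4_comult_def by (rule klinearI) (simp_all add: lin_ext_linear)

lemma klinear_id: "klinear id"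
  by (rule klinearI) simp_all

text \<open>
  The cofaces \<open>t \<mapsto> 1 \<otimes> t\<close>, \<open>(\<Delta> \<otimes> id) t\<close>, \<open>(id \<otimes> \<Delta>) t\<close> and \<open>t \<otimes> 1\<close> of the cobar complex.  All four are
  algebra homomorphisms, so everything about the reassociator of a twist can be computed in the
  algebra \<open>mult3\<close> without looking at tensor components.
\<close>
definition coface0 :: "'k::field ^ (h4_index \<times> h4_index) \<Rightarrow> 'k ^ (h4_index \<times> h4_index \<times> h4_index)"
  where "coface0 t = h4_one \<otimes>\<^sub>t t"
definition coface1 :: "'k::field ^ (h4_index \<times> h4_index) \<Rightarrow> 'k ^ (h4_index \<times> h4_index \<times> h4_index)"
  where "coface1 t = tens_assoc (tens_map h4_comult id t)"
definition coface2 :: "'k::field ^ (h4_index \<times> h4_index) \<Rightarrow> 'k ^ (h4_index \<times> h4_index \<times> h4_index)"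
  where "coface2 t = tens_map id h4_comult t"
definition coface3 :: "'k::field ^ (h4_index \<times> h4_index) \<Rightarrow> 'k ^ (h4_index \<times> h4_index \<times> h4_index)"
  where "coface3 t = tens_assoc (t \<otimes>\<^sub>t h4_one)"

lemmas coface_defs = coface0_def coface1_def coface2_def coface3_def

lemma coface_add:
  "coface0 (s + t) = coface0 s + coface0 t" "coface1 (s + t) = coface1 s + coface1 t"
  "coface2 (s + t) = coface2 s + coface2 t" "coface3 (s + t) = coface3 s + coface3 t"
  by (simp_all add: coface_defs tens_map_add tens_assoc_add tens_bilinear)

lemma coface_scale:
  "coface0 (r *s t) = r *s coface0 t" "coface1 (r *s t) = r *s coface1 t"
  "coface2 (r *s t) = r *s coface2 t" "coface3 (r *s t) = r *s coface3 t"
  by (simp_all add: coface_defs tens_map_scale tens_assoc_scale tens_bilinear)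

lemma coface_tens:
  "coface0 (a \<otimes>\<^sub>t b) = h4_one \<otimes>\<^sub>t a \<otimes>\<^sub>t b"
  "coface1 (a \<otimes>\<^sub>t b) = tens_assoc (h4_comult a \<otimes>\<^sub>t b)"
  "coface2 (a \<otimes>\<^sub>t b) = a \<otimes>\<^sub>t h4_comult b"
  "coface3 (a \<otimes>\<^sub>t b) = a \<otimes>\<^sub>t b \<otimes>\<^sub>t h4_one"
  by (simp_all add: coface_defs tens_map_tens klinear_comult klinear_id tens_assoc_tens)

lemma coface_one:
  "coface0 one2 = one3" "coface1 one2 = one3" "coface2 one2 = one3" "coface3 one2 = one3"
  by (simp_all add: coface_tens h4_comult_generators tens_assoc_tens)

lemma coface_mult:
  "coface0 (s \<bullet>\<^sub>2 t) = coface0 s \<bullet>\<^sub>3 coface0 t" "coface1 (s \<bullet>\<^sub>2 t) = coface1 s \<bullet>\<^sub>3 coface1 t"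
  "coface2 (s \<bullet>\<^sub>2 t) = coface2 s \<bullet>\<^sub>3 coface2 t" "coface3 (s \<bullet>\<^sub>2 t) = coface3 s \<bullet>\<^sub>3 coface3 t"
proof -
  note alg = h4.fd_algebra_axioms h4_2.fd_algebra_axioms
  note assoc_mult = tens_assoc_mult[OF alg(1) alg(1) alg(1), symmetric]
  show "coface0 (s \<bullet>\<^sub>2 t) = coface0 s \<bullet>\<^sub>3 coface0 t"
    by (simp add: coface0_def h4_mult3_tens h4_algebra)
  show "coface1 (s \<bullet>\<^sub>2 t) = coface1 s \<bullet>\<^sub>3 coface1 t"
    using tens_map_mult[OF alg(1) alg(1) alg(2) alg(1) klinear_comult klinear_id, of s t]
    by (simp add: coface1_def assoc_mult h4_comult_mult)
  show "coface2 (s \<bullet>\<^sub>2 t) = coface2 s \<bullet>\<^sub>3 coface2 t"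
    using tens_map_mult[OF alg(1) alg(1) alg(1) alg(2) klinear_id klinear_comult, of s t]
    by (simp add: coface2_def h4_comult_mult)
  show "coface3 (s \<bullet>\<^sub>2 t) = coface3 s \<bullet>\<^sub>3 coface3 t"
    by (simp add: coface3_def assoc_mult tens_mult_pure[OF alg(2) alg(1)] h4_algebra)
qed

lemma H4_sel:
  "qmult H4 = (\<bullet>\<^sub>h)" "qunit H4 = h4_one" "qcomult H4 = h4_comult" "qcounit H4 = h4_counit"
  "qassoc H4 = one3" "qantipode H4 = h4_antipode" "qalpha H4 = h4_one" "qbeta H4 = h4_one"
  "qmult2 H4 = mult2" "qunit2 H4 = one2" "qmult3 H4 = mult3"
  by (simp_all add: H4_def qmult2_def qmult3_def qunit2_def)

lemma twisted_sel:
  "qmult (twisted H F) = qmult H" "qunit (twisted H F) = qunit H"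
  "qcomult (twisted H F) = (\<lambda>h. qmult2 H (qmult2 H F (qcomult H h)) (qinv2 H F))"
  "qcounit (twisted H F) = qcounit H" "qassoc (twisted H F) = twist_assoc H F"
  "qantipode (twisted H F) = qantipode H"
  "qalpha (twisted H F) = twist_alpha H F" "qbeta (twisted H F) = twist_beta H F"
  by (simp_all add: twisted_def)

definition inverse2 :: "'k::field ^ (h4_index \<times> h4_index) \<Rightarrow> 'k ^ (h4_index \<times> h4_index) \<Rightarrow> bool"
  where "inverse2 F G \<longleftrightarrow> F \<bullet>\<^sub>2 G = one2 \<and> G \<bullet>\<^sub>2 F = one2"

lemma inverse2_cancel:
  assumes "inverse2 F G"
  shows "F \<bullet>\<^sub>2 (G \<bullet>\<^sub>2 t) = t" "G \<bullet>\<^sub>2 (F \<bullet>\<^sub>2 t) = t"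
  using assms by (simp_all add: inverse2_def flip: h4_2.assoc add: h4_2.left_unit)

lemma inverse2_mult:
  assumes "inverse2 F G" "inverse2 J K"
  shows "inverse2 (F \<bullet>\<^sub>2 J) (K \<bullet>\<^sub>2 G)"
  using assms inverse2_cancel[OF assms(1)] inverse2_cancel[OF assms(2)]
  by (simp add: inverse2_def h4_2.assoc)

lemma coface_inverse:
  assumes "inverse2 F G"
  shows "coface0 F \<bullet>\<^sub>3 coface0 G = one3" "coface1 F \<bullet>\<^sub>3 coface1 G = one3"
    "coface2 F \<bullet>\<^sub>3 coface2 G = one3" "coface3 F \<bullet>\<^sub>3 coface3 G = one3"
    "coface0 G \<bullet>\<^sub>3 coface0 F = one3" "coface1 G \<bullet>\<^sub>3 coface1 F = one3"
    "coface2 G \<bullet>\<^sub>3 coface2 F = one3" "coface3 G \<bullet>\<^sub>3 coface3 F = one3"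
  using assms by (simp_all add: inverse2_def coface_one flip: coface_mult)

lemma qinv2_H4: "inverse2 F G \<Longrightarrow> qinv2 H4 F = G"
  by (simp add: qinv2_def H4_sel inverse2_def h4_2.alg_inv_eqI)

text \<open>
  Since \<open>\<Phi> = 1\<close> for \<open>H4\<close>, only the four cofaces remain.
\<close>
lemma twist_assoc_H4:
  assumes "inverse2 F G"
  shows "twist_assoc H4 F = coface0 F \<bullet>\<^sub>3 (coface2 F \<bullet>\<^sub>3 (coface1 G \<bullet>\<^sub>3 coface3 G))"
  by (simp add: twist_assoc_def Let_def qinv2_H4[OF assms] H4_sel coface_defs h4_3.assoc h4_3.left_unit)

definition invariant2 :: "'k::field ^ (h4_index \<times> h4_index) \<Rightarrow> bool"
  where "invariant2 J \<longleftrightarrow> (\<forall>h. J \<bullet>\<^sub>2 h4_comult h = h4_comult h \<bullet>\<^sub>2 J)"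

lemma invariant2_inverse:
  assumes "invariant2 J" "inverse2 J K"
  shows "invariant2 K"
  unfolding invariant2_def
proof
  fix h
  have "K \<bullet>\<^sub>2 h4_comult h = K \<bullet>\<^sub>2 ((h4_comult h \<bullet>\<^sub>2 J) \<bullet>\<^sub>2 K)"
    using assms(2) by (simp add: inverse2_def h4_2.assoc h4_2.right_unit)
  also have "h4_comult h \<bullet>\<^sub>2 J = J \<bullet>\<^sub>2 h4_comult h" using assms(1) by (simp add: invariant2_def)
  finally show "K \<bullet>\<^sub>2 h4_comult h = h4_comult h \<bullet>\<^sub>2 K"
    by (simp add: h4_2.assoc inverse2_cancel[OF assms(2)])
qed

text \<open>
  On \<open>F = a \<otimes> b\<close> these say that \<open>a \<otimes> J \<Delta>(b) = a \<otimes> \<Delta>(b) J\<close> and \<open>J \<Delta>(a) \<otimes> b = \<Delta>(a) J \<otimes> b\<close>.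
\<close>
lemma coface_commute:
  assumes "invariant2 J"
  shows "coface0 J \<bullet>\<^sub>3 coface2 F = coface2 F \<bullet>\<^sub>3 coface0 J"
    and "coface3 J \<bullet>\<^sub>3 coface1 F = coface1 F \<bullet>\<^sub>3 coface3 J"
proof -
  note alg = h4.fd_algebra_axioms h4_2.fd_algebra_axioms
  have J: "J \<bullet>\<^sub>2 h4_comult h = h4_comult h \<bullet>\<^sub>2 J" for h
    using assms by (simp add: invariant2_def)
  show "coface0 J \<bullet>\<^sub>3 coface2 F = coface2 F \<bullet>\<^sub>3 coface0 J"
    by (induction F rule: tens_induct)
      (simp_all add: coface_add tens_mult_bilinear coface_tens coface0_def h4_mult3_tens h4_algebra J)
  show "coface3 J \<bullet>\<^sub>3 coface1 F = coface1 F \<bullet>\<^sub>3 coface3 J"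
    by (induction F rule: tens_induct)
      (simp_all add: coface_add tens_mult_bilinear coface_tens coface3_def h4_algebra J
        tens_assoc_mult[OF alg(1) alg(1) alg(1), symmetric] tens_mult_pure[OF alg(2) alg(1)])
qed

text \<open>
  With \<open>K\<close> the inverse of \<open>J\<close>, moving the cofaces of \<open>J\<close> and \<open>K\<close> past those of \<open>F\<close> and \<open>G\<close> turns the
  reassociator of \<open>F J\<close> into \<open>A C D B\<close>, where \<open>A B\<close> is the reassociator of \<open>F\<close> and \<open>C D\<close> that of \<open>J\<close>.  As \<open>A\<close>
  and \<open>B\<close> are invertible, the two reassociators agree if and only if that of \<open>J\<close> is trivial.
\<close>
lemma twist_assoc_mult_eq_iff:
  assumes F: "inverse2 F G" and J: "inverse2 J K" and inv: "invariant2 J"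
  shows "twist_assoc H4 (F \<bullet>\<^sub>2 J) = twist_assoc H4 F
    \<longleftrightarrow> coface0 J \<bullet>\<^sub>3 coface2 J = coface3 J \<bullet>\<^sub>3 coface1 J"
proof -
  define A where "A = coface0 F \<bullet>\<^sub>3 coface2 F"
  define B where "B = coface1 G \<bullet>\<^sub>3 coface3 G"
  define C where "C = coface0 J \<bullet>\<^sub>3 coface2 J"
  define D where "D = coface1 K \<bullet>\<^sub>3 coface3 K"
  have cancel: "s \<bullet>\<^sub>3 t = one3 \<Longrightarrow> s \<bullet>\<^sub>3 (t \<bullet>\<^sub>3 r) = r" for s t r :: "'a ^ (h4_index \<times> h4_index \<times> h4_index)"
    by (simp add: h4_3.left_unit flip: h4_3.assoc)
  note inverses = coface_inverse[OF F] coface_inverse[OF J]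
    coface_inverse[OF F, THEN cancel] coface_inverse[OF J, THEN cancel]
  have A: "coface2 G \<bullet>\<^sub>3 coface0 G \<bullet>\<^sub>3 A = one3"
    unfolding A_def by (simp add: h4_3.assoc inverses)
  have B: "B \<bullet>\<^sub>3 (coface3 F \<bullet>\<^sub>3 coface1 F) = one3"
    unfolding B_def by (simp add: h4_3.assoc inverses)
  have D: "D \<bullet>\<^sub>3 (coface3 J \<bullet>\<^sub>3 coface1 J) = one3" "(coface3 J \<bullet>\<^sub>3 coface1 J) \<bullet>\<^sub>3 D = one3"
    unfolding D_def by (simp_all add: h4_3.assoc inverses)
  have "twist_assoc H4 (F \<bullet>\<^sub>2 J)
      = coface0 F \<bullet>\<^sub>3 ((coface0 J \<bullet>\<^sub>3 coface2 F) \<bullet>\<^sub>3 (coface2 J \<bullet>\<^sub>3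
        (coface1 K \<bullet>\<^sub>3 ((coface1 G \<bullet>\<^sub>3 coface3 K) \<bullet>\<^sub>3 coface3 G))))"
    by (simp add: twist_assoc_H4[OF inverse2_mult[OF F J]] coface_mult h4_3.assoc)
  also have "\<dots> = A \<bullet>\<^sub>3 ((C \<bullet>\<^sub>3 D) \<bullet>\<^sub>3 B)"
    unfolding A_def B_def C_def D_def
      coface_commute(1)[OF inv, of F] coface_commute(2)[OF invariant2_inverse[OF inv J], of G, symmetric]
    by (simp only: h4_3.assoc)
  finally have FJ: "twist_assoc H4 (F \<bullet>\<^sub>2 J) = A \<bullet>\<^sub>3 ((C \<bullet>\<^sub>3 D) \<bullet>\<^sub>3 B)" .
  have F: "twist_assoc H4 F = A \<bullet>\<^sub>3 B"
    by (simp add: twist_assoc_H4[OF F] A_def B_def h4_3.assoc)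
  have "C \<bullet>\<^sub>3 D = one3" if "A \<bullet>\<^sub>3 ((C \<bullet>\<^sub>3 D) \<bullet>\<^sub>3 B) = A \<bullet>\<^sub>3 B"
  proof -
    have "(C \<bullet>\<^sub>3 D) \<bullet>\<^sub>3 B = B"
      using arg_cong[OF that, of "\<lambda>t. coface2 G \<bullet>\<^sub>3 coface0 G \<bullet>\<^sub>3 t"]
      by (simp only: cancel[OF A])
    then have "((C \<bullet>\<^sub>3 D) \<bullet>\<^sub>3 B) \<bullet>\<^sub>3 (coface3 F \<bullet>\<^sub>3 coface1 F) = one3"
      by (simp only: B)
    then show ?thesis by (simp only: h4_3.assoc[of "C \<bullet>\<^sub>3 D"] B h4_3.right_unit)
  qed
  then have "A \<bullet>\<^sub>3 ((C \<bullet>\<^sub>3 D) \<bullet>\<^sub>3 B) = A \<bullet>\<^sub>3 B \<longleftrightarrow> C \<bullet>\<^sub>3 D = one3"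
    by (metis h4_3.left_unit)
  also have "\<dots> \<longleftrightarrow> C = coface3 J \<bullet>\<^sub>3 coface1 J"
    by (metis D h4_3.assoc h4_3.left_unit h4_3.right_unit)
  finally show ?thesis by (simp only: FJ F C_def)
qed

lemma twisted_comult_mult_eq_iff:
  assumes F: "inverse2 F G" and J: "inverse2 J K"
  shows "qcomult (twisted H4 (F \<bullet>\<^sub>2 J)) = qcomult (twisted H4 F) \<longleftrightarrow> invariant2 J"
proof -
  have "(F \<bullet>\<^sub>2 J) \<bullet>\<^sub>2 h4_comult h \<bullet>\<^sub>2 (K \<bullet>\<^sub>2 G) = F \<bullet>\<^sub>2 h4_comult h \<bullet>\<^sub>2 G
      \<longleftrightarrow> J \<bullet>\<^sub>2 h4_comult h = h4_comult h \<bullet>\<^sub>2 J" (is "?L = ?R \<longleftrightarrow> _") for h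
  proof
    assume "?L = ?R"
    then have "G \<bullet>\<^sub>2 ?L \<bullet>\<^sub>2 (F \<bullet>\<^sub>2 J) = G \<bullet>\<^sub>2 ?R \<bullet>\<^sub>2 (F \<bullet>\<^sub>2 J)" by simp
    then show "J \<bullet>\<^sub>2 h4_comult h = h4_comult h \<bullet>\<^sub>2 J"
      using F J inverse2_cancel[OF F] inverse2_cancel[OF J]
      by (simp add: h4_2.assoc inverse2_def h4_2.right_unit)
  next
    assume *: "J \<bullet>\<^sub>2 h4_comult h = h4_comult h \<bullet>\<^sub>2 J"
    have "?L = F \<bullet>\<^sub>2 (J \<bullet>\<^sub>2 h4_comult h) \<bullet>\<^sub>2 (K \<bullet>\<^sub>2 G)" by (simp add: h4_2.assoc)
    also have "\<dots> = ?R" unfolding * by (simp add: h4_2.assoc inverse2_cancel[OF J])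
    finally show "?L = ?R" .
  qed
  then show ?thesis
    by (simp add: twisted_sel qinv2_H4[OF F] qinv2_H4[OF inverse2_mult[OF F J]] H4_sel
        fun_eq_iff invariant2_def)
qed


section \<open>The scaling automorphisms of Sweedler's algebra\<close>

text \<open>
  The Hopf algebra automorphism with \<open>g \<mapsto> g\<close> and \<open>x \<mapsto> \<omega> x\<close>.
\<close>
definition h4_scale :: "'k::field \<Rightarrow> 'k h4 \<Rightarrow> 'k h4"
  where "h4_scale \<omega> a = (\<chi> i. if snd i then \<omega> * a $ i else a $ i)"

lemma h4_scale_nth: "h4_scale \<omega> a $ (p, False) = a $ (p, False)" "h4_scale \<omega> a $ (p, True) = \<omega> * a $ (p, True)"
  by (simp_all add: h4_scale_def)

lemma klinear_scale: "klinear (h4_scale \<omega>)"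
  by (rule klinearI) (simp_all add: h4_scale_def vec_eq_iff algebra_simps)

lemma h4_antipode_nth:
  "h4_antipode a $ (False, False) = a $ (False, False)" "h4_antipode a $ (True, False) = a $ (True, False)"
  "h4_antipode a $ (False, True) = a $ (True, True)" "h4_antipode a $ (True, True) = - a $ (False, True)"
  by (simp_all add: h4_antipode_def lin_ext_def UNIV_h4_index h4_mult_nth h4_one_def h4_g_def h4_x_def axis_def)

lemma h4_scale_values:
  "h4_scale \<omega> h4_one = h4_one" "h4_scale \<omega> h4_g = h4_g" "h4_scale \<omega> h4_x = \<omega> *s h4_x"
  "h4_scale \<omega> (h4_g \<bullet>\<^sub>h h4_x) = \<omega> *s (h4_g \<bullet>\<^sub>h h4_x)"
  "h4_scale \<omega> p\<^sub>+ = p\<^sub>+" "h4_scale \<omega> p\<^sub>- = p\<^sub>-"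
  "h4_scale \<omega> (p\<^sub>+ \<bullet>\<^sub>h h4_x) = \<omega> *s (p\<^sub>+ \<bullet>\<^sub>h h4_x)" "h4_scale \<omega> (p\<^sub>- \<bullet>\<^sub>h h4_x) = \<omega> *s (p\<^sub>- \<bullet>\<^sub>h h4_x)"
  by (rule h4_eqI; simp add: h4_scale_nth h4_mult_nth h4_one_def h4_g_def h4_x_def h4_pp_def h4_pm_def axis_def)+

lemma h4_scale_mult: "h4_scale \<omega> (a \<bullet>\<^sub>h b) = h4_scale \<omega> a \<bullet>\<^sub>h h4_scale \<omega> b"
  by (rule h4_eqI) (simp_all add: h4_scale_nth h4_mult_nth algebra_simps)

abbreviation scale2 where "scale2 \<omega> \<equiv> tens_map (h4_scale \<omega>) (h4_scale \<omega>)"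
abbreviation scale3 where "scale3 \<omega> \<equiv> tens_map (h4_scale \<omega>) (scale2 \<omega>)"

lemma scale2_mult: "scale2 \<omega> (s \<bullet>\<^sub>2 t) = scale2 \<omega> s \<bullet>\<^sub>2 scale2 \<omega> t"
  using tens_map_mult[OF h4.fd_algebra_axioms h4.fd_algebra_axioms h4.fd_algebra_axioms
      h4.fd_algebra_axioms klinear_scale[of \<omega>] klinear_scale[of \<omega>], of s t]
  by (simp add: h4_scale_mult)

lemma scale3_mult: "scale3 \<omega> (s \<bullet>\<^sub>3 t) = scale3 \<omega> s \<bullet>\<^sub>3 scale3 \<omega> t"
  using tens_map_mult[OF h4.fd_algebra_axioms h4_2.fd_algebra_axioms h4.fd_algebra_axioms
      h4_2.fd_algebra_axioms klinear_scale[of \<omega>] klinear_tens_map[of "h4_scale \<omega>" "h4_scale \<omega>"], of s t]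
  by (simp add: h4_scale_mult scale2_mult)

lemma scale_tens:
  "scale2 \<omega> (a \<otimes>\<^sub>t b) = h4_scale \<omega> a \<otimes>\<^sub>t h4_scale \<omega> b"
  "scale3 \<omega> (a \<otimes>\<^sub>t s) = h4_scale \<omega> a \<otimes>\<^sub>t scale2 \<omega> s"
  by (simp_all add: tens_map_tens klinear_scale klinear_tens_map)

lemma scale2_comult: "scale2 \<omega> (h4_comult a) = h4_comult (h4_scale \<omega> a)"
proof -
  note lin = klinearD[OF klinear_comult] klinearD[OF klinear_scale] klinearD[OF klinear_tens_map]
  show ?thesis
    by (subst (1 2) h4_expand[of a])
      (simp add: lin h4_comult_generators h4_comult_gx h4_mult2_tens tens_mult_bilinear scale_tens
        h4_scale_values h4_scale_mult h4_relations h4_algebra h4_mult_bilinear tens_bilinear,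
        simp add: vec_eq_iff algebra_simps)
qed

lemma scale3_coface:
  "scale3 \<omega> (coface0 t) = coface0 (scale2 \<omega> t)" "scale3 \<omega> (coface1 t) = coface1 (scale2 \<omega> t)"
  "scale3 \<omega> (coface2 t) = coface2 (scale2 \<omega> t)" "scale3 \<omega> (coface3 t) = coface3 (scale2 \<omega> t)"
proof -
  have *: "scale3 \<omega> (tens_assoc (s \<otimes>\<^sub>t b)) = tens_assoc (scale2 \<omega> s \<otimes>\<^sub>t h4_scale \<omega> b)" for s and b :: "'a h4"
    by (induction s rule: tens_induct)
      (simp_all add: tens_bilinear tens_assoc_add tens_map_add tens_assoc_tens scale_tens)
  show "scale3 \<omega> (coface0 t) = coface0 (scale2 \<omega> t)" "scale3 \<omega> (coface3 t) = coface3 (scale2 \<omega> t)"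
    by (simp_all add: coface_defs scale_tens * h4_scale_values)
  show "scale3 \<omega> (coface1 t) = coface1 (scale2 \<omega> t)"
    by (induction t rule: tens_induct)
      (simp_all add: coface_add tens_map_add coface_tens * scale2_comult scale_tens)
  show "scale3 \<omega> (coface2 t) = coface2 (scale2 \<omega> t)"
    by (induction t rule: tens_induct)
      (simp_all add: coface_add tens_map_add coface_tens scale2_comult scale_tens)
qed

lemma inverse2_scale: "inverse2 F G \<Longrightarrow> inverse2 (scale2 \<omega> F) (scale2 \<omega> G)"
  by (simp add: inverse2_def scale_tens h4_scale_values flip: scale2_mult)

lemma scale2_twist:
  fixes a :: "'k::field_char_0"
  shows "scale2 \<omega> (h4_twist a b c \<mu> \<nu> \<tau> u v w)
    = h4_twist a (\<omega> * b) (\<omega> * c) (\<omega> * \<mu>) (\<omega>\<^sup>2 * \<nu>) (\<omega>\<^sup>2 * \<tau>) (\<omega> * u) (\<omega>\<^sup>2 * v) (\<omega>\<^sup>2 * w)"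
  unfolding h4_twist_def tens_map_add tens_map_scale scale_tens h4_scale_values tens_bilinear
  by (simp add: vec_eq_iff power2_eq_square algebra_simps)

lemma inverse2_twist:
  fixes a :: "'k::field_char_0"
  assumes "a \<noteq> 0"
  shows "inverse2 (h4_twist a b c \<mu> \<nu> \<tau> u v w)
    (h4_twist (1/a) (-b/a) (-c/a) (-\<mu>/a) (-\<nu>/a) (c*\<mu>/a-\<tau>) (-u/a) (u*b/a-v) (-w/a))"
  using assms by (simp add: inverse2_def h4_twist_mult h4_twist_trivial field_simps)

lemma h4_antipode_values:
  "h4_antipode h4_one = (h4_one :: 'k::field_char_0 h4)"
  "h4_antipode p\<^sub>+ = (p\<^sub>+ :: 'k h4)" "h4_antipode p\<^sub>- = (p\<^sub>- :: 'k h4)"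
  "h4_antipode (p\<^sub>+ \<bullet>\<^sub>h h4_x) = (p\<^sub>- \<bullet>\<^sub>h h4_x :: 'k h4)"
  "h4_antipode (p\<^sub>- \<bullet>\<^sub>h h4_x) = - (p\<^sub>+ \<bullet>\<^sub>h h4_x :: 'k h4)"
  by (rule h4_eqI; simp add: h4_antipode_nth h4_mult_nth h4_one_def h4_g_def h4_x_def h4_pp_def h4_pm_def axis_def)+

text \<open>
  As \<open>\<alpha> = \<beta> = 1\<close> for \<open>H4\<close>, the elements \<open>\<alpha>\<close> and \<open>\<beta>\<close> of a twist are obtained by applying these two linear
  maps to the inverse of the twist and to the twist itself.
\<close>
lemma antipode_contraction_tens:
  fixes a b :: "'k::field h4"
  shows "lin_ext (\<lambda>(i, j). h4_antipode (axis i 1) \<bullet>\<^sub>h axis j 1) (a \<otimes>\<^sub>t b) = h4_antipode a \<bullet>\<^sub>h b"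
    and "lin_ext (\<lambda>(i, j). axis i 1 \<bullet>\<^sub>h h4_antipode (axis j 1)) (a \<otimes>\<^sub>t b) = a \<bullet>\<^sub>h h4_antipode b"
  by (rule h4_eqI; simp add: lin_ext_def sum_UNIV_pair[where 'i = h4_index and 'j = h4_index]
      UNIV_h4_index h4_antipode_nth h4_mult_nth tens_def axis_def algebra_simps)+

text \<open>
  Terms with two factors \<open>x\<close> vanish by \<open>x\<^sup>2 = 0\<close>.  The terms of \<open>b\<close> and \<open>\<mu>\<close> become multiples of
  \<open>p\<^sub>- p\<^sub>+ x = 0\<close>, since \<open>S(p\<^sub>- x) = - p\<^sub>+ x\<close> and \<open>p\<^sub>- x p\<^sub>- = p\<^sub>- p\<^sub>+ x\<close>.
\<close>
lemma twist_beta_twist: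
  fixes a :: "'k::field_char_0"
  shows "twist_beta H4 (h4_twist a b c \<mu> \<nu> \<tau> u v w)
    = p\<^sub>+ + a *s p\<^sub>- + c *s (p\<^sub>- \<bullet>\<^sub>h h4_x) + u *s (p\<^sub>+ \<bullet>\<^sub>h h4_x)"
  by (simp add: twist_beta_def H4_sel h4_algebra(1,2) h4_twist_def lin_ext_linear antipode_contraction_tens
      h4_antipode_values h4_idem(1-16) h4_mult_bilinear)

lemma antipode_left_contraction_twist:
  fixes a :: "'k::field_char_0"
  shows "lin_ext (\<lambda>(i, j). h4_antipode (axis i 1) \<bullet>\<^sub>h axis j 1) (h4_twist a b c \<mu> \<nu> \<tau> u v w)
    = p\<^sub>+ + a *s p\<^sub>- + b *s (p\<^sub>- \<bullet>\<^sub>h h4_x) - \<mu> *s (p\<^sub>+ \<bullet>\<^sub>h h4_x)"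
  by (simp add: h4_twist_def lin_ext_linear antipode_contraction_tens h4_algebra(1,2)
      h4_antipode_values h4_idem(1-16) h4_mult_bilinear)

lemma twist_alpha_twist:
  fixes a :: "'k::field_char_0"
  assumes "a \<noteq> 0"
  shows "twist_alpha H4 (h4_twist a b c \<mu> \<nu> \<tau> u v w)
    = p\<^sub>+ + (1/a) *s p\<^sub>- - (b/a) *s (p\<^sub>- \<bullet>\<^sub>h h4_x) + (\<mu>/a) *s (p\<^sub>+ \<bullet>\<^sub>h h4_x)"
  unfolding twist_alpha_def qinv2_H4[OF inverse2_twist[OF assms]] H4_sel h4_algebra(2)
    antipode_left_contraction_twist
  by simp

lemma quasi_hopf_iso_scale:
  fixes a b c \<mu> \<nu> \<tau> u v w :: "'k::field_char_0"
  assumes "a \<noteq> 0" "\<omega> \<noteq> 0"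
  defines "F \<equiv> h4_twist a b c \<mu> \<nu> \<tau> u v w"
  shows "quasi_hopf_iso (twisted H4 F) (twisted H4 (scale2 \<omega> F)) (h4_scale \<omega>)"
proof -
  obtain G where inv: "inverse2 F G" using inverse2_twist[OF assms(1)] F_def by blast
  note inv' = inverse2_scale[OF inv]
  have "bij (h4_scale \<omega>)"
    by (rule o_bij[of "h4_scale (1/\<omega>)"]) (use assms in \<open>auto simp: fun_eq_iff h4_scale_def vec_eq_iff\<close>)
  moreover have "h4_antipode (h4_scale \<omega> h) = h4_scale \<omega> (h4_antipode h)" for h
    by (rule h4_eqI) (simp_all add: h4_antipode_nth h4_scale_nth)
  moreover have "h4_scale \<omega> (twist_alpha H4 F) = twist_alpha H4 (scale2 \<omega> F)"
    unfolding F_def scale2_twist twist_alpha_twist[OF assms(1)]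
    by (simp add: klinearD[OF klinear_scale] vec.linear_diff[OF klinear_scale] h4_scale_values mult_ac)
  moreover have "h4_scale \<omega> (twist_beta H4 F) = twist_beta H4 (scale2 \<omega> F)"
    unfolding F_def scale2_twist twist_beta_twist
    by (simp add: klinearD[OF klinear_scale] h4_scale_values mult_ac)
  moreover have "scale3 \<omega> (twist_assoc H4 F) = twist_assoc H4 (scale2 \<omega> F)"
    by (simp add: twist_assoc_H4[OF inv] twist_assoc_H4[OF inv'] scale3_mult scale3_coface)
  ultimately show ?thesis
    by (simp add: quasi_hopf_iso_def twisted_sel H4_sel klinear_scale h4_scale_values h4_scale_mult
        qinv2_H4[OF inv] qinv2_H4[OF inv'] scale2_mult scale2_comult h4_counit_def h4_scale_nth)
qed

text \<open>
  The antipode is the identity on the span of \<open>1\<close> and \<open>g\<close>, while its square is \<open>-1\<close> on the span of \<open>x\<close> and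
  \<open>gx\<close>.  Hence \<open>f g\<close> lies in the former span; having square \<open>1\<close> and counit \<open>1\<close>, and being different
  from \<open>f 1 = 1\<close>, it is \<open>g\<close>.  Then \<open>f x\<close> anticommutes with \<open>g\<close>, so it lies in the span of \<open>x\<close> and \<open>gx\<close>.
  There \<open>S a = - g a\<close> holds only for multiples of \<open>x\<close>.
\<close>
lemma quasi_hopf_iso_eq_scale:
  fixes F F' :: "'k::field_char_0 ^ (h4_index \<times> h4_index)"
  assumes "quasi_hopf_iso (twisted H4 F) (twisted H4 F') f"
  obtains \<omega> where "\<omega> \<noteq> 0" "f = h4_scale \<omega>"
proof -
  have lin: "klinear f" and "bij f" and one: "f h4_one = h4_one"
    and mult: "f (a \<bullet>\<^sub>h b) = f a \<bullet>\<^sub>h f b"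
    and counit: "h4_counit (f a) = h4_counit a"
    and antipode: "f (h4_antipode a) = h4_antipode (f a)" for a b
    using assms by (simp_all add: quasi_hopf_iso_def twisted_sel H4_sel)
  note f = klinearD[OF lin] vec.linear_neg[OF lin]
  have inj: "f a = f b \<Longrightarrow> a = b" for a b using \<open>bij f\<close> by (metis bij_pointE)
  define y z where "y = f h4_g" and "z = f h4_x"
  have "h4_antipode y = y" using antipode[of h4_g] by (simp add: y_def h4_antipode_generators)
  then have "y $ (True, True) = y $ (False, True)" "- y $ (False, True) = y $ (True, True)"
    by (metis h4_antipode_nth)+
  then have y0: "y $ (True, True) = 0" "y $ (False, True) = 0" by (auto simp: neg_eq_iff_add_eq_0 simp flip: mult_2)
  have "y \<bullet>\<^sub>h y = h4_one" using mult[of h4_g h4_g] by (simp add: y_def h4_relations one)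
  from arg_cong[OF this, of "\<lambda>a. a $ (True, False)"]
  have "y $ (False, False) * y $ (True, False) = 0"
    by (simp add: h4_mult_nth h4_one_def axis_def mult_ac flip: mult_2)
  moreover have y1: "y $ (False, False) + y $ (True, False) = 1"
    using counit[of h4_g] by (simp add: y_def h4_counit_def h4_g_def axis_def)
  moreover have "y \<noteq> h4_one" using inj[of h4_g h4_one] one
    by (auto simp: y_def h4_g_def h4_one_def axis_eq_axis)
  then have "y $ (True, False) \<noteq> 0"
    using y0 y1 by (auto intro!: h4_eqI simp: h4_one_def axis_def)
  ultimately have "y $ (False, False) = 0" "y $ (True, False) = 1" by auto
  then have y: "y = h4_g" using y0 by (auto intro!: h4_eqI simp: h4_g_def axis_def)
  have "z \<bullet>\<^sub>h h4_g = - (h4_g \<bullet>\<^sub>h z)"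
    using mult[of h4_x h4_g] mult[of h4_g h4_x] y by (simp add: h4_relations f y_def z_def)
  from arg_cong[OF this, of "\<lambda>a. a $ (True, False)"] arg_cong[OF this, of "\<lambda>a. a $ (False, False)"]
  have z0: "z $ (False, False) = 0" "z $ (True, False) = 0"
    by (simp_all add: h4_mult_nth h4_g_def axis_def eq_neg_iff_add_eq_0 flip: mult_2)
  have "h4_antipode z = - (h4_g \<bullet>\<^sub>h z)"
    using antipode[of h4_x] mult[of h4_g h4_x] y by (simp add: h4_antipode_generators f y_def z_def)
  from arg_cong[OF this, of "\<lambda>a. a $ (False, True)"]
  have "z $ (True, True) = 0"
    by (simp_all add: h4_mult_nth h4_antipode_nth h4_g_def axis_def eq_neg_iff_add_eq_0 flip: mult_2)
  with z0 have z: "z = z $ (False, True) *s h4_x" by (auto intro!: h4_eqI simp: h4_x_def axis_def)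
  have "f a = h4_scale (z $ (False, True)) a" for a
    by (subst (1 2) h4_expand[of a])
      (simp add: f klinearD[OF klinear_scale] mult one y[unfolded y_def] z[unfolded z_def, symmetric]
        z_def h4_scale_mult h4_scale_values)
  moreover have "z $ (False, True) \<noteq> 0"
  proof
    assume "z $ (False, True) = 0"
    then have "f h4_x = f 0" using z by (simp add: z_def f)
    then show False using inj by (force simp: h4_x_def)
  qed
  ultimately show thesis using that by blast
qed

section \<open>The invariant two-cocycles\<close>

text \<open>
  For signs \<open>s\<close> and \<open>s'\<close> these functionals are tensor products of vectors of the basis dual to
  \<open>p\<^sub>+\<close>, \<open>p\<^sub>-\<close>, \<open>p\<^sub>+ x\<close>, \<open>p\<^sub>- x\<close>; the sign selects \<open>p\<^sub>+\<close> or \<open>p\<^sub>-\<close>, and \<open>q\<close> tells whether \<open>x\<close> is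
  present.  They read off the coefficients of a twist.
\<close>
definition h4_dual :: "bool \<Rightarrow> 'k \<Rightarrow> bool \<Rightarrow> 'k \<Rightarrow> 'k::field ^ (h4_index \<times> h4_index) \<Rightarrow> 'k"
  where "h4_dual q s q' s' t = t $ ((False, q), (False, q')) + s' * t $ ((False, q), (True, q'))
    + s * t $ ((True, q), (False, q')) + s * s' * t $ ((True, q), (True, q'))"

lemma h4_dual_simps:
  "h4_dual q s q' s' (t + t') = h4_dual q s q' s' t + h4_dual q s q' s' t'"
  "h4_dual q s q' s' (r *s t) = r * h4_dual q s q' s' t"
  "h4_dual q s q' s' (t - t') = h4_dual q s q' s' t - h4_dual q s q' s' t'"
  "h4_dual q s q' s' (a \<otimes>\<^sub>t b) = (a $ (False, q) + s * a $ (True, q)) * (b $ (False, q') + s' * b $ (True, q'))"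
  by (simp_all add: h4_dual_def tens_def algebra_simps)

lemma tens_diff:
  "(a - a') \<otimes>\<^sub>t b = a \<otimes>\<^sub>t b - a' \<otimes>\<^sub>t b" "a \<otimes>\<^sub>t (b - b') = a \<otimes>\<^sub>t b - a \<otimes>\<^sub>t b'"
  by (simp_all add: tens_def vec_eq_iff algebra_simps)

lemma tens_mult_diff:
  "tens_mult m n (s - s') t = tens_mult m n s t - tens_mult m n s' t"
  "tens_mult m n s (t - t') = tens_mult m n s t - tens_mult m n s t'"
  using tens_mult_bilinear(1)[of m n "s - s'" s' t] tens_mult_bilinear(2)[of m n s "t - t'" t']
  by (simp_all add: algebra_simps)

lemma h4_idem_nth:
  "(p\<^sub>+ :: 'k::field h4) $ (p, q) = (if q then 0 else 1 / 2)"
  "(p\<^sub>- :: 'k h4) $ (p, q) = (if q then 0 else if p then - 1 / 2 else 1 / 2)"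
  "(p\<^sub>+ \<bullet>\<^sub>h h4_x :: 'k h4) $ (p, q) = (if q then 1 / 2 else 0)"
  "(p\<^sub>- \<bullet>\<^sub>h h4_x :: 'k h4) $ (p, q) = (if q then if p then - 1 / 2 else 1 / 2 else 0)"
  by (cases p; cases q; simp add: h4_mult_nth h4_one_def h4_g_def h4_x_def h4_pp_def h4_pm_def axis_def)+

lemma invariant2_iff:
  "invariant2 J \<longleftrightarrow> J \<bullet>\<^sub>2 h4_comult h4_g = h4_comult h4_g \<bullet>\<^sub>2 J \<and> J \<bullet>\<^sub>2 h4_comult h4_x = h4_comult h4_x \<bullet>\<^sub>2 J"
    (is "_ \<longleftrightarrow> ?g \<and> ?x")
proof
  assume "?g \<and> ?x"
  then have g: ?g and x: ?x by auto
  have gx: "J \<bullet>\<^sub>2 h4_comult (h4_g \<bullet>\<^sub>h h4_x) = h4_comult (h4_g \<bullet>\<^sub>h h4_x) \<bullet>\<^sub>2 J"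
    unfolding h4_comult_mult by (metis g x h4_2.assoc)
  show "invariant2 J"
    unfolding invariant2_def
  proof
    fix h
    show "J \<bullet>\<^sub>2 h4_comult h = h4_comult h \<bullet>\<^sub>2 J"
      by (subst (1 2) h4_expand[of h])
        (simp add: klinearD[OF klinear_comult] tens_mult_bilinear g x gx h4_comult_generators(1)
          h4_2.left_unit h4_2.right_unit)
  qed
qed (simp add: invariant2_def)

text \<open>
  Conjugation by \<open>g \<otimes> g\<close> negates the terms with exactly one \<open>x\<close>, which removes \<open>b\<close>, \<open>c\<close>, \<open>\<mu>\<close> and \<open>u\<close>.  The
  terms with two factors \<open>x\<close> are annihilated by \<open>\<Delta>(x)\<close> from both sides, and \<open>p\<^sub>- \<otimes> p\<^sub>-\<close> does not commute
  with \<open>\<Delta>(x)\<close>, so its coefficient must be the one it has in \<open>1 \<otimes> 1\<close>.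
\<close>
lemma invariant2_twistD:
  fixes a :: "'k::field_char_0"
  assumes "invariant2 (h4_twist a b c \<mu> \<nu> \<tau> u v w)" (is "invariant2 ?J")
  shows "a = 1" "b = 0" "c = 0" "\<mu> = 0" "u = 0"
proof -
  define P M X Y :: "'k h4" where "P = p\<^sub>+" and "M = p\<^sub>-" and "X = p\<^sub>+ \<bullet>\<^sub>h h4_x" and "Y = p\<^sub>- \<bullet>\<^sub>h h4_x"
  note idem = h4_idem[where ?'k = 'k, folded P_def M_def X_def Y_def]
  note tw = h4_twist_def[where ?'k = 'k, folded P_def M_def X_def Y_def]
  note nth = h4_idem_nth[where ?'k = 'k, folded P_def M_def X_def Y_def]
  have g: "h4_g = P - M" and x: "h4_x = X + Y"
    by (rule h4_eqI; simp add: nth h4_g_def h4_x_def axis_def)+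
  note ev = tw g x idem h4_mult2_tens tens_mult_bilinear tens_mult_diff tens_bilinear tens_diff
    h4_mult_bilinear h4_dual_simps nth
  have "h4_dual q s q' s' (?J \<bullet>\<^sub>2 h4_comult h) = h4_dual q s q' s' (h4_comult h \<bullet>\<^sub>2 ?J)" for q s q' s' h
    using assms by (simp add: invariant2_def)
  note eq_g = this[of _ _ _ _ h4_g, unfolded h4_comult_generators]
    and eq_x = this[of _ _ _ _ h4_x, unfolded h4_comult_generators]
  show "b = 0" using eq_g[of False "-1" True "-1"] by (simp add: ev)
  show "c = 0" using eq_g[of False "-1" True "1"] by (simp add: ev)
  show "\<mu> = 0" using eq_g[of True "-1" False "-1"] by (simp add: ev)
  show "u = 0" using eq_g[of True "1" False "-1"] by (simp add: ev)
  show "a = 1" using eq_x[of False "-1" True "-1"] by (simp add: ev)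
qed

text \<open>
  The cocycle equation is more transparent in the basis \<open>g\<^sup>i x\<^sup>j\<close>, on which \<open>\<Delta>\<close> has at most two terms, than
  in terms of the idempotents.
\<close>
lemma twist_standard_basis:
  fixes \<nu> :: "'k::field_char_0"
  shows "h4_twist 1 0 0 0 \<nu> \<tau> 0 v w = one2
    + (((\<nu> + \<tau> + v + w) / 4) *s (h4_x \<otimes>\<^sub>t h4_x) + ((- \<nu> + \<tau> - v + w) / 4) *s (h4_x \<otimes>\<^sub>t h4_g \<bullet>\<^sub>h h4_x)
    + ((- \<nu> - \<tau> + v + w) / 4) *s (h4_g \<bullet>\<^sub>h h4_x \<otimes>\<^sub>t h4_x)
    + ((\<nu> - \<tau> - v + w) / 4) *s (h4_g \<bullet>\<^sub>h h4_x \<otimes>\<^sub>t h4_g \<bullet>\<^sub>h h4_x))"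
proof -
  have pp: "p\<^sub>+ \<bullet>\<^sub>h h4_x = (1/2) *s (h4_x + h4_g \<bullet>\<^sub>h (h4_x :: 'k h4))"
    and pm: "p\<^sub>- \<bullet>\<^sub>h h4_x = (1/2) *s (h4_x + (-1) *s (h4_g \<bullet>\<^sub>h (h4_x :: 'k h4)))"
    by (rule h4_eqI; simp add: h4_idem_nth h4_mult_nth h4_g_def h4_x_def axis_def)+
  have "h4_twist 1 0 0 0 \<nu> \<tau> 0 v w = h4_twist 1 0 0 0 0 0 0 0 0
    + \<nu> *s (p\<^sub>- \<bullet>\<^sub>h h4_x \<otimes>\<^sub>t p\<^sub>- \<bullet>\<^sub>h h4_x) + \<tau> *s (p\<^sub>- \<bullet>\<^sub>h h4_x \<otimes>\<^sub>t p\<^sub>+ \<bullet>\<^sub>h h4_x)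
    + v *s (p\<^sub>+ \<bullet>\<^sub>h h4_x \<otimes>\<^sub>t p\<^sub>- \<bullet>\<^sub>h h4_x) + w *s (p\<^sub>+ \<bullet>\<^sub>h h4_x \<otimes>\<^sub>t p\<^sub>+ \<bullet>\<^sub>h h4_x)"
    by (simp add: h4_twist_def)
  also have "\<dots> = one2
    + (((\<nu> + \<tau> + v + w) / 4) *s (h4_x \<otimes>\<^sub>t h4_x) + ((- \<nu> + \<tau> - v + w) / 4) *s (h4_x \<otimes>\<^sub>t h4_g \<bullet>\<^sub>h h4_x)
    + ((- \<nu> - \<tau> + v + w) / 4) *s (h4_g \<bullet>\<^sub>h h4_x \<otimes>\<^sub>t h4_x)
    + ((\<nu> - \<tau> - v + w) / 4) *s (h4_g \<bullet>\<^sub>h h4_x \<otimes>\<^sub>t h4_g \<bullet>\<^sub>h h4_x))"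
    unfolding h4_twist_trivial pp pm tens_bilinear
    by (simp add: vec_eq_iff field_simps)
  finally show ?thesis .
qed

text \<open>
  The products of two cofaces of \<open>N\<close> that occur vanish, since each of their terms contains \<open>x\<^sup>2\<close> in one
  tensor factor.  What remains is the condition that \<open>N\<close> be an additive two-cocycle.  Among the
  \<open>g\<^sup>i x \<otimes> g\<^sup>j x\<close> only \<open>gx \<otimes> x\<close> has this property: the terms with \<open>1\<close> or \<open>g\<close> in the first tensor factor
  cancel only for \<open>i = 1\<close>, those with \<open>1\<close> or \<open>g\<close> in the last one only for \<open>j = 0\<close>.
\<close>
lemma xx_cocycle_iff:
  fixes r s t n :: "'k::field_char_0"
  defines "N \<equiv> r *s (h4_x \<otimes>\<^sub>t h4_x) + s *s (h4_x \<otimes>\<^sub>t h4_g \<bullet>\<^sub>h h4_x)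
    + t *s (h4_g \<bullet>\<^sub>h h4_x \<otimes>\<^sub>t h4_x) + n *s (h4_g \<bullet>\<^sub>h h4_x \<otimes>\<^sub>t h4_g \<bullet>\<^sub>h h4_x)"
  shows "coface0 (one2 + N) \<bullet>\<^sub>3 coface2 (one2 + N) = coface3 (one2 + N) \<bullet>\<^sub>3 coface1 (one2 + N)
    \<longleftrightarrow> r = 0 \<and> s = 0 \<and> n = 0"
proof -
  note ev = N_def coface_add coface_scale coface_tens h4_comult_generators h4_comult_gx
    h4_mult2_tens h4_mult3_tens h4_normalize h4_relations(1,2) tens_bilinear tens_assoc_add tens_assoc_scale
    tens_assoc_tens tens_mult_bilinear h4_mult_bilinear h4_algebra
  have "coface0 N \<bullet>\<^sub>3 coface2 N = 0" "coface3 N \<bullet>\<^sub>3 coface1 N = 0"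
    by (simp_all add: ev)
  then have "coface0 (one2 + N) \<bullet>\<^sub>3 coface2 (one2 + N) = coface3 (one2 + N) \<bullet>\<^sub>3 coface1 (one2 + N)
      \<longleftrightarrow> coface0 N + coface2 N = coface3 N + coface1 N" (is "_ \<longleftrightarrow> ?L = ?R")
    by (simp add: coface_add coface_one tens_mult_bilinear h4_3.left_unit h4_3.right_unit add_ac)
  also have "\<dots> \<longleftrightarrow> r = 0 \<and> s = 0 \<and> n = 0"
  proof
    assume eq: "?L = ?R"
    note eq = eq[simplified ev]
    note nth = h4_mult_nth tens_def h4_one_def h4_g_def h4_x_def axis_def
    \<comment> \<open>The coefficients of \<open>1 \<otimes> x \<otimes> x\<close>, \<open>1 \<otimes> x \<otimes> gx\<close> and \<open>gx \<otimes> gx \<otimes> 1\<close>.\<close>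
    show "r = 0 \<and> s = 0 \<and> n = 0"
      using arg_cong[OF eq, of "\<lambda>t. t $ ((False, False), (False, True), (False, True))"]
        arg_cong[OF eq, of "\<lambda>t. t $ ((False, False), (False, True), (True, True))"]
        arg_cong[OF eq, of "\<lambda>t. t $ ((True, True), (True, True), (False, False))"]
      by (simp add: nth)
  next
    assume "r = 0 \<and> s = 0 \<and> n = 0"
    then show "?L = ?R" by (simp add: ev vector_add_ldistrib add_ac)
  qed
  finally show ?thesis .
qed

text \<open>
  In terms of the idempotents, \<open>- \<kappa> gx \<otimes> x\<close> has the coefficients \<open>\<kappa>\<close>, \<open>\<kappa>\<close>, \<open>- \<kappa>\<close>, \<open>- \<kappa>\<close>.
\<close>
lemma invariant_cocycle_twist_iff:
  fixes a b c \<mu> \<nu> \<tau> u v w :: "'k::field_char_0"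
  defines "J \<equiv> h4_twist a b c \<mu> \<nu> \<tau> u v w"
  shows "invariant2 J \<and> coface0 J \<bullet>\<^sub>3 coface2 J = coface3 J \<bullet>\<^sub>3 coface1 J
    \<longleftrightarrow> (\<exists>\<kappa>. (a, b, c, \<mu>, \<nu>, \<tau>, u, v, w) = (1, 0, 0, 0, \<kappa>, \<kappa>, 0, - \<kappa>, - \<kappa>))"
    (is "?L \<longleftrightarrow> ?R")
proof
  assume ?L
  then have J: "invariant2 J" and cocycle: "coface0 J \<bullet>\<^sub>3 coface2 J = coface3 J \<bullet>\<^sub>3 coface1 J" by auto
  note D = invariant2_twistD[OF J[unfolded J_def]]
  from cocycle have "\<nu> + \<tau> + v + w = 0" "- \<nu> + \<tau> - v + w = 0" "\<nu> - \<tau> - v + w = 0"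
    unfolding J_def D twist_standard_basis xx_cocycle_iff by simp_all
  then have "2 * \<tau> = 2 * \<nu>" "2 * v = 2 * (- \<nu>)" "2 * w = 2 * (- \<nu>)" by algebra+
  then have "\<tau> = \<nu>" "v = - \<nu>" "w = - \<nu>" by (metis mult_left_cancel zero_neq_numeral)+
  with D show ?R by simp
next
  assume ?R
  then obtain \<kappa> where J: "J = h4_twist 1 0 0 0 \<kappa> \<kappa> 0 (- \<kappa>) (- \<kappa>)" by (auto simp: J_def)
  have "invariant2 J" unfolding invariant2_iff J twist_standard_basis
    by (simp add: h4_comult_generators h4_mult2_tens h4_normalize h4_relations(1,2) tens_bilinear
      tens_mult_bilinear tens_mult_diff h4_mult_bilinear h4_algebra)
  moreover have "coface0 J \<bullet>\<^sub>3 coface2 J = coface3 J \<bullet>\<^sub>3 coface1 J"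
    unfolding J twist_standard_basis xx_cocycle_iff by simp
  ultimately show ?L ..
qed

text \<open>
  A bijection along which structure is transported determines the structure of its target.
\<close>
lemma quasi_hopf_iso_target:
  assumes "quasi_hopf_iso A B f" "quasi_hopf_iso A B' f"
  shows "qcomult B = qcomult B'" "qassoc B = qassoc B'"
proof -
  have "surj f" using assms(1) by (simp add: quasi_hopf_iso_def bij_def)
  show "qcomult B = qcomult B'"
  proof
    fix b
    obtain a where "b = f a" using \<open>surj f\<close> by blast
    then show "qcomult B b = qcomult B' b" using assms by (metis quasi_hopf_iso_def)
  qed
  show "qassoc B = qassoc B'" using assms by (simp add: quasi_hopf_iso_def)
qed

theorem proposition3p4:
  fixes a b c \<mu> \<nu> \<tau> u v w :: "'k :: {alg_closed_field, field_char_0}"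
    and a' b' c' \<mu>' \<nu>' \<tau>' u' v' w' :: 'k
  assumes "a \<noteq> 0" and "a' \<noteq> 0"
  shows "quasi_hopf_isomorphic
      (twisted H4 (h4_twist a b c \<mu> \<nu> \<tau> u v w))
      (twisted H4 (h4_twist a' b' c' \<mu>' \<nu>' \<tau>' u' v' w')) \<longleftrightarrow>
    a = a' \<and>
    (\<exists>\<omega> \<kappa>. \<omega> \<noteq> 0 \<and>
      (b', c', \<mu>', u') = (\<omega> * b, \<omega> * c, \<omega> * \<mu>, \<omega> * u) \<and>
      \<nu>' = \<omega>\<^sup>2 * \<nu> + \<kappa> * a \<and>
      \<tau>' = \<omega>\<^sup>2 * \<tau> + \<kappa> \<and>
      v' = \<omega>\<^sup>2 * v - \<kappa> \<and>
      w' = \<omega>\<^sup>2 * w - \<kappa>)"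
    (is "quasi_hopf_isomorphic (twisted H4 ?F) (twisted H4 ?F') \<longleftrightarrow> ?params")
proof
  assume "quasi_hopf_isomorphic (twisted H4 ?F) (twisted H4 ?F')"
  then obtain f where f: "quasi_hopf_iso (twisted H4 ?F) (twisted H4 ?F') f"
    by (auto simp: quasi_hopf_isomorphic_def)
  obtain \<omega> where \<omega>: "\<omega> \<noteq> 0" "f = h4_scale \<omega>" by (rule quasi_hopf_iso_eq_scale[OF f])
  define F\<omega> where "F\<omega> = scale2 \<omega> ?F"
  obtain G where G: "inverse2 F\<omega> G"
    unfolding F\<omega>_def using inverse2_scale[OF inverse2_twist[OF \<open>a \<noteq> 0\<close>]] by blast
  \<comment> \<open>These are the coefficients of \<open>J\<close> that solve \<open>F' = F\<omega> J\<close>, read off from the formula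
    \<open>h4_twist_mult\<close> for the product of two twists.\<close>
  define aJ where "aJ = a' / a"
  define bJ where "bJ = (b' - \<omega> * b) / a"
  define cJ where "cJ = c' - \<omega> * c * aJ"
  define mJ where "mJ = (\<mu>' - \<omega> * \<mu>) / a"
  define nJ where "nJ = (\<nu>' - \<omega>\<^sup>2 * \<nu>) / a"
  define tJ where "tJ = \<tau>' - \<omega>\<^sup>2 * \<tau> - \<omega> * c * mJ"
  define uJ where "uJ = u' - \<omega> * u * aJ"
  define vJ where "vJ = v' - \<omega>\<^sup>2 * v - \<omega> * u * bJ"
  define wJ where "wJ = w' - \<omega>\<^sup>2 * w * aJ"
  define J where "J = h4_twist aJ bJ cJ mJ nJ tJ uJ vJ wJ"
  have F': "?F' = F\<omega> \<bullet>\<^sub>2 J"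
    unfolding F\<omega>_def J_def scale2_twist h4_twist_mult
    using \<open>a \<noteq> 0\<close> by (simp add: aJ_def bJ_def cJ_def mJ_def nJ_def tJ_def uJ_def vJ_def wJ_def)
  have "aJ \<noteq> 0" using assms by (simp add: aJ_def)
  then obtain K where K: "inverse2 J K" unfolding J_def using inverse2_twist by blast
  note target = quasi_hopf_iso_target[OF f[unfolded \<omega>(2)] quasi_hopf_iso_scale[OF \<open>a \<noteq> 0\<close> \<omega>(1)],
      folded F\<omega>_def, unfolded F']
  have inv: "invariant2 J"
    using target(1) by (simp only: twisted_comult_mult_eq_iff[OF G K])
  moreover have "coface0 J \<bullet>\<^sub>3 coface2 J = coface3 J \<bullet>\<^sub>3 coface1 J"
    using target(2) by (simp only: twisted_sel twist_assoc_mult_eq_iff[OF G K inv])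
  ultimately obtain \<kappa> where \<kappa>: "(aJ, bJ, cJ, mJ, nJ, tJ, uJ, vJ, wJ) = (1, 0, 0, 0, \<kappa>, \<kappa>, 0, - \<kappa>, - \<kappa>)"
    unfolding J_def using invariant_cocycle_twist_iff by blast
  have "a' = a" using \<kappa> assms by (simp add: aJ_def)
  moreover have "b' = \<omega> * b" "\<mu>' = \<omega> * \<mu>" "c' = \<omega> * c" "u' = \<omega> * u"
    using \<kappa> assms by (simp_all add: bJ_def mJ_def cJ_def uJ_def)
  moreover have "\<nu>' = \<omega>\<^sup>2 * \<nu> + \<kappa> * a" "\<tau>' = \<omega>\<^sup>2 * \<tau> + \<kappa>"
    using \<kappa> assms by (simp_all add: nJ_def tJ_def field_simps)
  moreover have "v' = \<omega>\<^sup>2 * v - \<kappa>" "w' = \<omega>\<^sup>2 * w - \<kappa>"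
    using \<kappa> assms by (simp_all add: vJ_def wJ_def algebra_simps)
  ultimately show ?params using \<omega>(1) by blast
next
  assume ?params
  then obtain \<omega> \<kappa> where \<omega>: "\<omega> \<noteq> 0" and a': "a' = a"
    and params: "b' = \<omega> * b" "c' = \<omega> * c" "\<mu>' = \<omega> * \<mu>" "u' = \<omega> * u" "\<nu>' = \<omega>\<^sup>2 * \<nu> + \<kappa> * a"
      "\<tau>' = \<omega>\<^sup>2 * \<tau> + \<kappa>" "v' = \<omega>\<^sup>2 * v - \<kappa>" "w' = \<omega>\<^sup>2 * w - \<kappa>"
    by blast
  define F\<omega> where "F\<omega> = scale2 \<omega> ?F"
  define J where "J = h4_twist 1 0 0 0 \<kappa> \<kappa> 0 (- \<kappa>) (- \<kappa>)"
  obtain G where G: "inverse2 F\<omega> G"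
    unfolding F\<omega>_def using inverse2_scale[OF inverse2_twist[OF \<open>a \<noteq> 0\<close>]] by blast
  obtain K where K: "inverse2 J K" unfolding J_def using inverse2_twist[OF one_neq_zero] by blast
  have F': "?F' = F\<omega> \<bullet>\<^sub>2 J"
    unfolding F\<omega>_def J_def scale2_twist h4_twist_mult a' params by (simp add: mult_ac add_ac)
  have J: "invariant2 J" "coface0 J \<bullet>\<^sub>3 coface2 J = coface3 J \<bullet>\<^sub>3 coface1 J"
    unfolding J_def using invariant_cocycle_twist_iff by blast+
  have "twist_alpha H4 ?F' = twist_alpha H4 F\<omega>" "twist_beta H4 ?F' = twist_beta H4 F\<omega>"
    using \<open>a \<noteq> 0\<close> by (simp_all add: F\<omega>_def scale2_twist a' params twist_alpha_twist twist_beta_twist)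
  moreover have "twist_assoc H4 ?F' = twist_assoc H4 F\<omega>"
    unfolding F' using twist_assoc_mult_eq_iff[OF G K J(1)] J(2) by blast
  moreover have "qcomult (twisted H4 ?F') = qcomult (twisted H4 F\<omega>)"
    unfolding F' using twisted_comult_mult_eq_iff[OF G K] J(1) by blast
  ultimately have "twisted H4 ?F' = twisted H4 F\<omega>"
    by (intro quasi_hopf.equality) (simp_all add: twisted_sel twisted_def)
  then show "quasi_hopf_isomorphic (twisted H4 ?F) (twisted H4 ?F')"
    unfolding quasi_hopf_isomorphic_def F\<omega>_def using quasi_hopf_iso_scale[OF \<open>a \<noteq> 0\<close> \<omega>] by metis
qed

end
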